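(* Let $X\subseteq \mathbb{P}^1\times\mathbb{P}^1\times\mathbb{P}^1$ be a Ferrers variety of lines. Then $I_X$ is minimally generated by the set of forms $$\left\{ \prod_{i\le a}A_i\prod_{j\le b}B_j\prod_{k\le c}C_k \ :\ (a,b,c)\in \hat{D}(X) \right\}.$$
   Context: $R=K[x_{1,0},x_{1,1},x_{2,0},x_{2,1},x_{3,0},x_{3,1}]$ ($K$ algebraically closed, characteristic zero) trigraded by $\deg x_{i,j}=\mathbf e_i$, coordinate ring of $\mathbb{P}^1\times\mathbb{P}^1\times\mathbb{P}^1$. A variety of lines is $X= \bigcup_{(i,j)\in U_3(X)} \mathcal{L}(A_i,B_j)\cup\bigcup_{(i,k)\in U_2(X)} \mathcal{L}(A_i,C_k)\cup \bigcup_{(j,k)\in U_1(X)} \mathcal{L}(B_j,C_k)$, where $A_1,\ldots,A_{d_1}$, $B_1,\ldots,B_{d_2}$, $C_1,\ldots,C_{d_3}$ are linear forms of degrees $(1,0,0),(0,1,0),(0,0,1)$ defining the distinct hyperplanes containing some line of $X$, $\mathcal L(F,G)$ is the line defined by the ideal $(F,G)$, and $U_3(X)\subseteq[d_1]\times[d_2]$, $U_2(X)\subseteq[d_1]\times[d_3]$, $U_1(X)\subseteq[d_2]\times[d_3]$ with $[n]=\{1,\ldots,n\}$. Its ideal is $I_X=\bigcap_{U_3(X)} (A_i,B_j)\cap\bigcap_{U_2(X)} (A_i,C_k)\cap\bigcap_{U_1(X)} (B_j,C_k)$. $X$ is a Ferrers variety of lines if, for this labeling, each of $U_1(X),U_2(X),U_3(X)$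 is downward closed: $(u,v)\in U_h(X)\Rightarrow (u',v')\in U_h(X)$ for all $1\le u'\le u$, $1\le v'\le v$. Let $X_3,X_2,X_1$ be the unions of the lines of $X$ indexed by $U_3(X),U_2(X),U_1(X)$ respectively. Let $D_3(X)$ be the set of tridegrees (all of the form $(a,b,0)$) of a minimal homogeneous generating set of $I_{X_3}$, $D_2(X)$ the set of tridegrees (of the form $(a,0,c)$) of minimal generators of $I_{X_2}$, and $D_1(X)$ the set of tridegrees (of the form $(0,b,c)$) of minimal generators of $I_{X_1}$. Set $D(X)=\{(\max\{a_3,a_2\},\max\{b_3,b_1\},\max\{c_1,c_2\}) : (a_3,b_3,0)\in D_3(X),(a_2,0,c_2)\in D_2(X),(0,b_1,c_1)\in D_1(X)\}$ and let $\hat D(X)$ be the set of minimal elements of $D(X)$ with respect to the componentwise partial order on $\mathbb N^3$. *)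

theory Defs
  imports "HOL-Library.Poly_Mapping" "HOL-Computational_Algebra.Polynomial"
begin

datatype fac = F1 | F2 | F3
datatype var = Var fac bool   \<comment> \<open>Var F1 False = x_{1,0}, Var F1 True = x_{1,1}, etc.\<close>

type_synonym 'k mpoly = "(var \<Rightarrow>\<^sub>0 nat) \<Rightarrow>\<^sub>0 'k"

definition pvar :: "var \<Rightarrow> 'k::comm_ring_1 mpoly" where
  "pvar v = Poly_Mapping.single (Poly_Mapping.single v 1) 1"

definition pconst :: "'k::comm_ring_1 \<Rightarrow> 'k mpoly" where
  "pconst c = Poly_Mapping.single 0 c"

definition tdeg :: "(var \<Rightarrow>\<^sub>0 nat) \<Rightarrow> nat \<times> nat \<times> nat" where
  "tdeg m = (Poly_Mapping.lookup m (Var F1 False) + Poly_Mapping.lookup m (Var F1 True),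
             Poly_Mapping.lookup m (Var F2 False) + Poly_Mapping.lookup m (Var F2 True),
             Poly_Mapping.lookup m (Var F3 False) + Poly_Mapping.lookup m (Var F3 True))"

definition homogeneous :: "'k::comm_ring_1 mpoly \<Rightarrow> (nat \<times> nat \<times> nat) \<Rightarrow> bool" where
  "homogeneous p d \<longleftrightarrow> (\<forall>m \<in> Poly_Mapping.keys p. tdeg m = d)"

definition linear_form :: "fac \<Rightarrow> 'k::comm_ring_1 mpoly \<Rightarrow> bool" where
  "linear_form f L \<longleftrightarrow> (\<exists>\<alpha> \<beta>. (\<alpha>, \<beta>) \<noteq> (0, 0) \<and>
      L = pconst \<alpha> * pvar (Var f False) + pconst \<beta> * pvar (Var f True))"

definition ideal_gen :: "'k::comm_ring_1 mpoly set \<Rightarrow> 'k mpoly set" where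
  "ideal_gen S = {\<Sum>g\<in>F. c g * g | F c. finite F \<and> F \<subseteq> S}"

definition min_gens :: "'k::comm_ring_1 mpoly set \<Rightarrow> 'k mpoly set \<Rightarrow> bool" where
  "min_gens I G \<longleftrightarrow> ideal_gen G = I \<and> (\<forall>H. H \<subset> G \<longrightarrow> ideal_gen H \<noteq> I)"

definition min_hom_gens :: "'k::comm_ring_1 mpoly set \<Rightarrow> 'k mpoly set \<Rightarrow> bool" where
  "min_hom_gens I G \<longleftrightarrow> min_gens I G \<and> (\<forall>g\<in>G. \<exists>d. homogeneous g d)"

text \<open>Set of tridegrees of a minimal homogeneous generating set of I
  (this set does not depend on the choice of such a set).\<close>
definition gen_degrees :: "'k::comm_ring_1 mpoly set \<Rightarrow> (nat \<times> nat \<times> nat) set" where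
  "gen_degrees I = {d. \<exists>G. min_hom_gens I G \<and> (\<exists>g\<in>G. g \<noteq> 0 \<and> homogeneous g d)}"

definition down_closed :: "(nat \<times> nat) set \<Rightarrow> bool" where
  "down_closed U \<longleftrightarrow> (\<forall>u v u' v'. (u, v) \<in> U \<and> 1 \<le> u' \<and> u' \<le> u \<and> 1 \<le> v' \<and> v' \<le> v
      \<longrightarrow> (u', v') \<in> U)"

definition I3 :: "(nat \<Rightarrow> 'k::comm_ring_1 mpoly) \<Rightarrow> (nat \<Rightarrow> 'k mpoly) \<Rightarrow> (nat \<times> nat) set \<Rightarrow> 'k mpoly set" where
  "I3 A B U3 = (\<Inter>(i, j)\<in>U3. ideal_gen {A i, B j})"

definition D_set ::
  "(nat \<times> nat \<times> nat) set \<Rightarrow> (nat \<times> nat \<times> nat) set \<Rightarrow> (nat \<times> nat \<times> nat) set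
     \<Rightarrow> (nat \<times> nat \<times> nat) set" where
  "D_set D3 D2 D1 = {(max a3 a2, max b3 b1, max c1 c2) | a3 b3 a2 c2 b1 c1.
       (a3, b3, 0) \<in> D3 \<and> (a2, 0, c2) \<in> D2 \<and> (0, b1, c1) \<in> D1}"

definition le3 :: "nat \<times> nat \<times> nat \<Rightarrow> nat \<times> nat \<times> nat \<Rightarrow> bool" where
  "le3 x y \<longleftrightarrow> fst x \<le> fst y \<and> fst (snd x) \<le> fst (snd y) \<and> snd (snd x) \<le> snd (snd y)"

definition minimal_elems :: "(nat \<times> nat \<times> nat) set \<Rightarrow> (nat \<times> nat \<times> nat) set" where
  "minimal_elems D = {d \<in> D. \<not> (\<exists>e\<in>D. e \<noteq> d \<and> le3 e d)}"

end

(*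
  The polynomial ring is a domain, and every linear form L in the variables of one factor has a
  retraction: an endomorphism that kills L, is congruent to the identity modulo L and fixes the
  forms of the other factors. Hence (A_i, B_j) is the kernel of a composition of two retractions,
  so other forms can be cancelled modulo it.

  Given h in I_X, strip off A_1, A_2, ... one by one: h = A_1...A_n q, and replace q by its image r
  under the retraction of A_{n+1}. Since q lies in (A_{n+1}, B_j) for every j in row n+1 of U_3,
  r is divisible by these B_j, and likewise by the C_k with k in row n+1 of U_2; the same stripping along the B_j, applied to r, expresses
  A_1...A_n r by products of forms, and h - A_1...A_n r is divisible by A_1...A_{n+1}. The products
  occurring are those whose exponents (a, b, c) satisfy (a+1, b+1) not in U_3, (a+1, c+1) not in
  U_2 and (b+1, c+1) not in U_1.

  Forms whose tridegrees are an antichain minimally generate their ideal, and these tridegrees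
  are the generator degrees of the ideal. Taking two of the three U_h empty gives the sets D_h(X).
*)
theory Submission
  imports Defs "HOL-Library.Product_Plus"
begin

section \<open>The polynomial ring is a domain\<close>

text \<open>An injective numbering of the six variables, from which they inherit a linear
  order.\<close>

fun var_code :: "var \<Rightarrow> nat" where
  "var_code (Var F1 b) = (if b then 1 else 0)"
| "var_code (Var F2 b) = (if b then 3 else 2)"
| "var_code (Var F3 b) = (if b then 5 else 4)"

lemma var_code_inject: "var_code v = var_code w \<longleftrightarrow> v = w"
proof (cases v; cases w)
  fix f b g c
  assume "v = Var f b" "w = Var g c"
  then show ?thesis by (cases f; cases g) auto
qed

text \<open>The library shows that \<open>poly_mapping\<close> has no zero divisors only for linearly ordered
  exponents, which requires an order on the variables.\<close>

instantiation var :: linorder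
begin

definition less_eq_var :: "var \<Rightarrow> var \<Rightarrow> bool" where
  "v \<le> w \<longleftrightarrow> var_code v \<le> var_code w"

definition less_var :: "var \<Rightarrow> var \<Rightarrow> bool" where
  "v < w \<longleftrightarrow> var_code v < var_code w"

instance
  by standard (auto simp: less_eq_var_def less_var_def var_code_inject)

end

lemma UNIV_fac: "(UNIV :: fac set) = {F1, F2, F3}"
  using fac.exhaust by auto

lemma UNIV_var: "(UNIV :: var set) = (\<lambda>(f, b). Var f b) ` ({F1, F2, F3} \<times> UNIV)"
proof -
  have "v \<in> (\<lambda>(f, b). Var f b) ` ({F1, F2, F3} \<times> UNIV)" for v
  proof (cases v)
    case (Var f b)
    then show ?thesis using UNIV_fac by (intro image_eqI[of _ _ "(f, b)"]) auto
  qed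
  then show ?thesis by blast
qed

text \<open>Finiteness lets \<open>eval_monom\<close> multiply over all of \<open>UNIV\<close>, so
  that no support has to be tracked.\<close>

instance var :: finite
  by standard (simp add: UNIV_var)

section \<open>Ideals\<close>

lemma ideal_gen_mono: "S \<subseteq> S' \<Longrightarrow> ideal_gen S \<subseteq> ideal_gen S'"
  unfolding ideal_gen_def by blast

lemma ideal_gen_base:
  assumes "g \<in> S" shows "g \<in> ideal_gen S"
proof -
  have "g = (\<Sum>x\<in>{g}. (\<lambda>_. 1) x * x)" by simp
  then show ?thesis unfolding ideal_gen_def
    using assms by (intro CollectI exI[of _ "{g}"] exI[of _ "\<lambda>_. 1"] conjI) auto
qed

lemma ideal_gen_zero [simp]: "0 \<in> ideal_gen S"
proof -
  have "0 = (\<Sum>x\<in>{}. (\<lambda>_. 1) x * x)" by simp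
  then show ?thesis unfolding ideal_gen_def by (intro CollectI exI[of _ "{}"] exI conjI) auto
qed

lemma ideal_gen_mult:
  assumes "g \<in> ideal_gen S" shows "h * g \<in> ideal_gen S"
proof -
  obtain F c where F: "finite F" "F \<subseteq> S" "g = (\<Sum>x\<in>F. c x * x)"
    using assms unfolding ideal_gen_def by blast
  have "h * g = (\<Sum>x\<in>F. (h * c x) * x)"
    by (simp add: F(3) sum_distrib_left mult.assoc)
  then show ?thesis unfolding ideal_gen_def
    using F(1,2) by (intro CollectI exI[of _ F] exI[of _ "\<lambda>x. h * c x"]) auto
qed

lemma ideal_gen_add:
  assumes "g \<in> ideal_gen S" "h \<in> ideal_gen S" shows "g + h \<in> ideal_gen S"
proof -
  obtain F c where F: "finite F" "F \<subseteq> S" "g = (\<Sum>x\<in>F. c x * x)"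
    using assms unfolding ideal_gen_def by blast
  obtain F' c' where F': "finite F'" "F' \<subseteq> S" "h = (\<Sum>x\<in>F'. c' x * x)"
    using assms unfolding ideal_gen_def by blast
  have "g = (\<Sum>x\<in>F \<union> F'. (if x \<in> F then c x else 0) * x)"
    unfolding F(3) by (rule sum.mono_neutral_cong_left) (use F(1) F'(1) in auto)
  moreover have "h = (\<Sum>x\<in>F \<union> F'. (if x \<in> F' then c' x else 0) * x)"
    unfolding F'(3) by (rule sum.mono_neutral_cong_left) (use F(1) F'(1) in auto)
  ultimately have "g + h
      = (\<Sum>x\<in>F \<union> F'. ((if x \<in> F then c x else 0) + (if x \<in> F' then c' x else 0)) * x)"
    by (simp only: sum.distrib distrib_right)
  then show ?thesis unfolding ideal_gen_def
    using F(1,2) F'(1,2) by (intro CollectI exI[of _ "F \<union> F'"] exI conjI) auto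
qed

lemma ideal_gen_dvd: "g \<in> ideal_gen S \<Longrightarrow> g dvd h \<Longrightarrow> h \<in> ideal_gen S"
  by (auto simp: dvd_def mult.commute intro: ideal_gen_mult)

lemma ideal_gen_diff:
  assumes "g \<in> ideal_gen S" "h \<in> ideal_gen S" shows "g - h \<in> ideal_gen S"
  using ideal_gen_add[OF assms(1) ideal_gen_mult[OF assms(2), of "-1"]] by simp

lemma ideal_gen_sum:
  assumes "\<And>x. x \<in> F \<Longrightarrow> f x \<in> ideal_gen S" shows "(\<Sum>x\<in>F. f x) \<in> ideal_gen S"
  using assms by (induction F rule: infinite_finite_induct) (auto intro: ideal_gen_add)

lemma ideal_gen_subsetI:
  assumes "\<And>g. g \<in> S \<Longrightarrow> g \<in> ideal_gen S'" shows "ideal_gen S \<subseteq> ideal_gen S'"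
proof
  fix h assume "h \<in> ideal_gen S"
  then obtain F c where F: "finite F" "F \<subseteq> S" "h = (\<Sum>x\<in>F. c x * x)"
    unfolding ideal_gen_def by blast
  show "h \<in> ideal_gen S'" unfolding F(3)
    using F(2) assms by (intro ideal_gen_sum ideal_gen_mult) auto
qed

text \<open>Serves to carry an expansion of a remainder in forms of the last two factors over to its
  multiple by a product of forms of the first factor.\<close>

lemma ideal_gen_mult_left:
  assumes "r \<in> ideal_gen S" "\<And>g. g \<in> S \<Longrightarrow> p * g \<in> ideal_gen S'"
  shows "p * r \<in> ideal_gen S'"
proof -
  obtain F c where F: "F \<subseteq> S" "r = (\<Sum>g\<in>F. c g * g)"
    using assms(1) unfolding ideal_gen_def by blast
  have "p * r = (\<Sum>g\<in>F. c g * (p * g))"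
    by (simp add: F(2) sum_distrib_left mult.left_commute)
  also have "\<dots> \<in> ideal_gen S'"
    by (intro ideal_gen_sum ideal_gen_mult[OF assms(2)]) (use F(1) in auto)
  finally show ?thesis .
qed

lemma ideal_gen_pair: "h \<in> ideal_gen {a, b} \<longleftrightarrow> (\<exists>u v. h = u * a + v * b)"
proof
  assume "\<exists>u v. h = u * a + v * b"
  then show "h \<in> ideal_gen {a, b}"
    by (auto intro!: ideal_gen_add ideal_gen_mult intro: ideal_gen_base)
next
  assume "h \<in> ideal_gen {a, b}"
  then obtain F c where F: "F \<subseteq> {a, b}" "h = (\<Sum>x\<in>F. c x * x)"
    unfolding ideal_gen_def by blast
  consider "F = {}" | "F = {a}" | "F = {b}" | "F = {a, b}" "a \<noteq> b" using F(1) by blast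
  then show "\<exists>u v. h = u * a + v * b"
  proof cases
    case 1
    then show ?thesis using F(2) by (intro exI[of _ 0]) auto
  next
    case 2
    then have "h = c a * a + 0 * b" using F(2) by simp
    then show ?thesis by blast
  next
    case 3
    then have "h = 0 * a + c b * b" using F(2) by simp
    then show ?thesis by blast
  next
    case 4
    then have "h = c a * a + c b * b" using F(2) by simp
    then show ?thesis by blast
  qed
qed

section \<open>Monomials, substitution and retractions\<close>

text \<open>An update at a fresh key is the addition of a single term, so additive properties of
  polynomials need checking on terms only.\<close>

lemma poly_mapping_induct [case_names single add]:
  assumes single: "\<And>m c. P (Poly_Mapping.single m c)"
    and add: "\<And>p q. P p \<Longrightarrow> P q \<Longrightarrow> P (p + q)"
  shows "P (p :: 'a \<Rightarrow>\<^sub>0 'b::comm_monoid_add)"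
proof (induction p rule: update_induct)
  case const
  show ?case using single[of undefined 0] by simp
next
  case (update f a b)
  have "Poly_Mapping.update a b f = f + Poly_Mapping.single a b"
    using update(1) by (intro poly_mapping_eqI)
      (auto simp: lookup_update lookup_add lookup_single when_def in_keys_iff)
  then show ?case using update(3) single add by simp
qed

lemma single_eq_0_iff: "Poly_Mapping.single m c = 0 \<longleftrightarrow> c = 0"
  by (metis lookup_single_eq lookup_zero single_zero)

lemma pconst_mult: "pconst (c * d) = pconst c * pconst d"
  by (simp add: pconst_def mult_single)

lemma pconst_add: "pconst (c + d) = pconst c + pconst d"
  by (simp add: pconst_def single_add)

lemma pconst_0 [simp]: "pconst 0 = 0"
  by (simp add: pconst_def)

lemma pconst_1 [simp]: "pconst 1 = 1"
  by (simp add: pconst_def)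

definition eval_monom :: "(var \<Rightarrow> 'k::comm_ring_1 mpoly) \<Rightarrow> (var \<Rightarrow>\<^sub>0 nat) \<Rightarrow> 'k mpoly" where
  "eval_monom \<sigma> m = (\<Prod>v\<in>UNIV. \<sigma> v ^ Poly_Mapping.lookup m v)"

text \<open>The K-algebra endomorphism that sends each variable \<open>v\<close> to
  \<open>\<sigma> v\<close>.\<close>

definition subst :: "(var \<Rightarrow> 'k::comm_ring_1 mpoly) \<Rightarrow> 'k mpoly \<Rightarrow> 'k mpoly" where
  "subst \<sigma> p = (\<Sum>m\<in>Poly_Mapping.keys p. pconst (Poly_Mapping.lookup p m) * eval_monom \<sigma> m)"

lemma eval_monom_add: "eval_monom \<sigma> (m + n) = eval_monom \<sigma> m * eval_monom \<sigma> n"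
  by (simp add: eval_monom_def lookup_add power_add prod.distrib)

lemma eval_monom_0 [simp]: "eval_monom \<sigma> 0 = 1"
  by (simp add: eval_monom_def)

lemma eval_monom_single: "eval_monom \<sigma> (Poly_Mapping.single v n) = \<sigma> v ^ n"
proof -
  have "eval_monom \<sigma> (Poly_Mapping.single v n) = (\<Prod>w\<in>UNIV. if w = v then \<sigma> w ^ n else 1)"
    unfolding eval_monom_def
    by (rule prod.cong) (auto simp: lookup_single when_def)
  then show ?thesis by simp
qed

lemma subst_single: "subst \<sigma> (Poly_Mapping.single m c) = pconst c * eval_monom \<sigma> m"
  by (cases "c = 0") (simp_all add: subst_def)

lemma subst_add: "subst \<sigma> (p + q) = subst \<sigma> p + subst \<sigma> q"
  unfolding subst_def
  by (rule setsum_keys_plus_distrib) (auto simp: pconst_add distrib_right)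

lemma subst_mult: "subst \<sigma> (p * q) = subst \<sigma> p * subst \<sigma> q"
proof (induction p rule: poly_mapping_induct)
  case (single m c)
  show ?case
  proof (induction q rule: poly_mapping_induct)
    case (single n d)
    then show ?case by (simp add: mult_single subst_single eval_monom_add pconst_mult ac_simps)
  qed (simp add: subst_add distrib_left)
qed (simp add: subst_add distrib_right)

lemma subst_pconst [simp]: "subst \<sigma> (pconst c) = pconst c"
  by (simp add: pconst_def[of c] subst_single)

lemma subst_pvar [simp]: "subst \<sigma> (pvar v) = \<sigma> v"
  by (simp add: pvar_def subst_single eval_monom_single)

lemma single_sum: "Poly_Mapping.single (\<Sum>x\<in>F. f x) (1::'k::comm_ring_1)
    = (\<Prod>x\<in>F. Poly_Mapping.single (f x) 1)"
  by (induction F rule: infinite_finite_induct) (simp_all add: mult_single[where ?'b='k, of _ 1 _ 1, simplified, symmetric])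

text \<open>Presents a monomial as a product of powers of variables, the shape in which
  \<open>dvd_minus_subst\<close> compares it with its image.\<close>

lemma eval_monom_pvar: "eval_monom pvar m = Poly_Mapping.single m (1::'k::comm_ring_1)"
proof -
  have pow: "pvar v ^ n = Poly_Mapping.single (Poly_Mapping.single v n) (1::'k)" for v n
    by (induction n) (simp_all add: pvar_def mult_single flip: single_add)
  have m: "(\<Sum>v\<in>UNIV. Poly_Mapping.single v (Poly_Mapping.lookup m v)) = m"
    by (rule poly_mapping_eqI) (simp add: lookup_sum lookup_single when_def)
  show ?thesis by (simp add: eval_monom_def pow m flip: single_sum)
qed

section \<open>Congruences and retractions modulo a form\<close>

lemma dvd_minus_mult:
  fixes a :: "'a::comm_ring_1"
  assumes "a dvd x - y" "a dvd x' - y'" shows "a dvd x * x' - y * y'"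
proof -
  have "x * x' - y * y' = (x - y) * x' + y * (x' - y')" by (simp add: algebra_simps)
  then show ?thesis using assms by simp
qed

text \<open>Congruence modulo \<open>L\<close> respects sums and products, so it passes from the
  variables to powers, monomials and polynomials.\<close>

lemma dvd_minus_subst:
  assumes "\<And>v. L dvd pvar v - \<sigma> v" shows "L dvd p - subst \<sigma> p"
proof (induction p rule: poly_mapping_induct)
  case (single m c)
  have pow: "L dvd pvar v ^ n - \<sigma> v ^ n" for v n
    by (induction n) (auto intro: dvd_minus_mult assms)
  have "L dvd (\<Prod>v\<in>F. pvar v ^ Poly_Mapping.lookup m v) - (\<Prod>v\<in>F. \<sigma> v ^ Poly_Mapping.lookup m v)" for F
    by (induction F rule: infinite_finite_induct) (auto intro: dvd_minus_mult pow)
  then have "L dvd eval_monom pvar m - eval_monom \<sigma> m"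
    unfolding eval_monom_def .
  then have "L dvd pconst c * eval_monom pvar m - pconst c * eval_monom \<sigma> m"
    by (intro dvd_minus_mult) auto
  moreover have "pconst c * eval_monom pvar m = Poly_Mapping.single m c"
    by (simp add: eval_monom_pvar pconst_def mult_single)
  ultimately show ?case by (simp add: subst_single)
next
  case (add p q)
  have "p + q - subst \<sigma> (p + q) = (p - subst \<sigma> p) + (q - subst \<sigma> q)"
    by (simp add: subst_add)
  then show ?case using add by (metis dvd_add)
qed

text \<open>A model inside the ring of the quotient map modulo \<open>L\<close>: its kernel consists
  of the multiples of \<open>L\<close>, so divisibility turns into an equation.\<close>

definition retraction :: "'a::comm_ring_1 \<Rightarrow> ('a \<Rightarrow> 'a) \<Rightarrow> bool" where
  "retraction L \<phi> \<longleftrightarrow> (\<forall>g h. \<phi> (g + h) = \<phi> g + \<phi> h) \<and> (\<forall>g h. \<phi> (g * h) = \<phi> g * \<phi> h)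
     \<and> \<phi> L = 0 \<and> (\<forall>g. L dvd g - \<phi> g)"

lemma retraction_eq_0_iff:
  assumes "retraction L \<phi>" shows "\<phi> g = 0 \<longleftrightarrow> L dvd g"
proof
  assume "\<phi> g = 0"
  then show "L dvd g" using assms by (metis diff_zero retraction_def)
next
  assume "L dvd g"
  then show "\<phi> g = 0" using assms by (auto simp: retraction_def dvd_def)
qed

text \<open>Since \<open>\<phi>\<close> fixes \<open>M\<close>, it maps the ideal of the pair into
  the multiples of \<open>M\<close>, which \<open>\<psi>\<close> kills. Conversely \<open>h\<close>
  agrees with \<open>\<phi> h\<close> modulo \<open>L\<close>, and \<open>\<phi> h\<close> is then a
  multiple of \<open>M\<close>.\<close>

lemma retraction_pair_iff:
  assumes "retraction L \<phi>" "retraction M \<psi>" "\<phi> M = M"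
  shows "h \<in> ideal_gen {L, M} \<longleftrightarrow> \<psi> (\<phi> h) = 0"
proof
  assume "h \<in> ideal_gen {L, M}"
  then obtain u v where "h = u * L + v * M" by (auto simp: ideal_gen_pair)
  then have "\<phi> h = \<phi> v * M" using assms by (auto simp: retraction_def)
  then show "\<psi> (\<phi> h) = 0" using retraction_eq_0_iff[OF assms(2)] by simp
next
  assume "\<psi> (\<phi> h) = 0"
  then obtain v where v: "\<phi> h = M * v" using retraction_eq_0_iff[OF assms(2)] by (auto simp: dvd_def)
  obtain u where "h - \<phi> h = L * u" using assms(1) by (metis retraction_def dvd_def)
  then have "h = u * L + v * M" using v by (simp add: algebra_simps)
  then show "h \<in> ideal_gen {L, M}" by (auto simp: ideal_gen_pair)
qed

text \<open>The equation \<open>L = 0\<close> is solved for one variable of the factor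
  \<open>f\<close> and the solution is substituted. Forms of other factors do not contain that
  variable; a form of the same factor becomes a scalar times the remaining variable.\<close>

lemma linear_form_retraction:
  fixes L :: "'k::field mpoly"
  assumes "linear_form f L"
  obtains \<phi> where "retraction L \<phi>"
    and "\<And>g M. linear_form g M \<Longrightarrow> g \<noteq> f \<Longrightarrow> \<phi> M = M"
    and "\<And>M. linear_form f M \<Longrightarrow> \<phi> M = 0 \<Longrightarrow> \<exists>c. M = pconst c * L"
proof -
  obtain \<alpha> \<beta> where ab: "(\<alpha>, \<beta>) \<noteq> (0, 0)"
    "L = pconst \<alpha> * pvar (Var f False) + pconst \<beta> * pvar (Var f True)"
    using assms unfolding linear_form_def by blast
  \<comment> \<open>At least one coefficient is nonzero; \<open>b\<close> names the variable that
    carries it, so that both cases are treated alike.\<close>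
  obtain b \<alpha> \<beta> where L: "\<alpha> \<noteq> 0"
    "L = pconst \<alpha> * pvar (Var f b) + pconst \<beta> * pvar (Var f (\<not> b))"
  proof (cases "\<alpha> = 0")
    case True
    then show ?thesis using ab that[of \<beta> True \<alpha>] by (simp add: add.commute)
  next
    case False
    then show ?thesis using ab that[of \<alpha> False \<beta>] by simp
  qed
  define y :: "'k mpoly" where "y = pvar (Var f (\<not> b))"
  define \<sigma> where "\<sigma> = (pvar :: var \<Rightarrow> 'k mpoly)(Var f b := pconst (- \<beta> / \<alpha>) * y)"
  have \<sigma>: "\<sigma> (Var f b) = pconst (- \<beta> / \<alpha>) * y" "\<sigma> (Var f (\<not> b)) = y"
    "g \<noteq> f \<Longrightarrow> \<sigma> (Var g c) = pvar (Var g c)" for g c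
    by (auto simp: \<sigma>_def y_def)
  have y: "subst \<sigma> y = y" by (simp add: y_def \<sigma>)
  have cancel: "pconst \<alpha> * (pconst (- \<beta> / \<alpha>) * y) = - pconst \<beta> * y"
  proof -
    have "pconst \<alpha> * pconst (- \<beta> / \<alpha>) = pconst (- \<beta>)"
      using L(1) by (simp flip: pconst_mult)
    then show ?thesis by (simp add: pconst_def single_uminus flip: mult.assoc)
  qed
  have "L dvd pvar v - \<sigma> v" for v
  proof (cases "v = Var f b")
    case True
    have "pconst (1 / \<alpha>) * L = pvar v - \<sigma> v"
    proof -
      have "pconst (1 / \<alpha>) * L = pconst (1 / \<alpha> * \<alpha>) * pvar v + pconst (1 / \<alpha> * \<beta>) * y"
        using True by (simp only: L(2) y_def pconst_mult distrib_left mult.assoc)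
      also have "\<dots> = pvar v - pconst (- \<beta> / \<alpha>) * y"
        using L(1) by (simp add: pconst_def single_uminus)
      finally show ?thesis using \<sigma> True by simp
    qed
    then show ?thesis by (metis dvd_triv_right)
  next
    case False
    then show ?thesis by (simp add: \<sigma>_def)
  qed
  then have "retraction L (subst \<sigma>)"
    unfolding retraction_def
    by (auto simp: subst_add subst_mult L(2) \<sigma> y cancel[simplified] simp flip: y_def intro: dvd_minus_subst)
  moreover have "subst \<sigma> M = M" if "linear_form g M" "g \<noteq> f" for g M
    using that by (auto simp: linear_form_def subst_add subst_mult \<sigma>)
  moreover have "\<exists>c. M = pconst c * L" if "linear_form f M" and 0: "subst \<sigma> M = 0" for M
  proof -
    obtain \<alpha>' \<beta>' where M: "M = pconst \<alpha>' * pvar (Var f b) + pconst \<beta>' * y"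
    proof -
      obtain \<mu> \<nu> where "M = pconst \<mu> * pvar (Var f False) + pconst \<nu> * pvar (Var f True)"
        using \<open>linear_form f M\<close> unfolding linear_form_def by blast
      then show ?thesis
        using that[of \<mu> \<nu>] that[of \<nu> \<mu>] by (cases b) (auto simp: y_def add.commute)
    qed
    \<comment> \<open>The left side is the image of \<open>M\<close>. Its scalar must vanish, which
      says that the coefficients of \<open>M\<close> and \<open>L\<close> are proportional.\<close>
    have "pconst (\<alpha>' * (- \<beta> / \<alpha>) + \<beta>') * y = 0"
      using 0 by (simp only: M subst_add subst_mult subst_pconst subst_pvar \<sigma> y pconst_mult
          pconst_add distrib_right mult.assoc)
    then have "\<beta>' = \<alpha>' / \<alpha> * \<beta>"
      by (auto simp: y_def pvar_def pconst_def mult_single single_eq_0_iff)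
    moreover have "\<alpha>' = \<alpha>' / \<alpha> * \<alpha>" using L(1) by simp
    ultimately have "M = pconst (\<alpha>' / \<alpha>) * L"
      unfolding M L(2) y_def distrib_left mult.assoc[symmetric] pconst_mult[symmetric] by metis
    then show ?thesis by blast
  qed
  ultimately show ?thesis using that by blast
qed

section \<open>Tridegrees\<close>

lemma tdeg_add: "tdeg (m + n) = tdeg m + tdeg n"
  by (simp add: tdeg_def lookup_add)

lemma tdeg_eq_0_iff: "tdeg m = 0 \<longleftrightarrow> m = 0"
proof
  assume m: "tdeg m = 0"
  have "Poly_Mapping.lookup m (Var f b) = 0" for f b
    using m by (cases f; cases b) (auto simp: tdeg_def zero_prod_def)
  then show "m = 0" by (intro poly_mapping_eqI) (metis lookup_zero var.exhaust)
qed (simp add: tdeg_def zero_prod_def)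

text \<open>Comparability in the componentwise order amounts to the existence of a tridegree
  \<open>k\<close> for the cofactor.\<close>

lemma le3_iff: "le3 e d \<longleftrightarrow> (\<exists>k. d = k + e)"
proof
  assume "le3 e d"
  then have "d = (fst d - fst e, fst (snd d) - fst (snd e), snd (snd d) - snd (snd e)) + e"
    by (cases d; cases e) (auto simp: le3_def)
  then show "\<exists>k. d = k + e" by blast
qed (auto simp: le3_def)

lemma le3_refl [simp]: "le3 d d"
  by (simp add: le3_def)

lemma le3_trans: "le3 d e \<Longrightarrow> le3 e f \<Longrightarrow> le3 d f"
  by (auto simp: le3_def)

lemma le3_antisym: "le3 d e \<Longrightarrow> le3 e d \<Longrightarrow> d = e"
  by (auto simp: le3_def prod_eq_iff)

definition component :: "nat \<times> nat \<times> nat \<Rightarrow> 'k::comm_ring_1 mpoly \<Rightarrow> 'k mpoly" where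
  "component d p = Poly_Mapping.mapp (\<lambda>m c. if tdeg m = d then c else 0) p"

lemma lookup_component:
  "Poly_Mapping.lookup (component d p) m = (if tdeg m = d then Poly_Mapping.lookup p m else 0)"
  by (auto simp: component_def lookup_mapp when_def in_keys_iff)

lemma component_0 [simp]: "component d 0 = 0"
  by (rule poly_mapping_eqI) (simp add: lookup_component)

lemma component_add: "component d (p + q) = component d p + component d q"
  by (rule poly_mapping_eqI) (simp add: lookup_component lookup_add)

lemma component_sum: "component d (\<Sum>x\<in>F. f x) = (\<Sum>x\<in>F. component d (f x))"
  by (induction F rule: infinite_finite_induct) (simp_all add: component_add)

lemma component_homogeneous:
  assumes "homogeneous p e" shows "component d p = (if d = e then p else 0)"
  using assms
  by (intro poly_mapping_eqI) (auto simp: lookup_component homogeneous_def in_keys_iff)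

lemma homogeneous_mult:
  assumes "homogeneous p d" "homogeneous q e" shows "homogeneous (p * q) (d + e)"
  using assms keys_mult[of p q] by (fastforce simp: homogeneous_def tdeg_add)

lemma homogeneous_unique:
  assumes "p \<noteq> 0" "homogeneous p d" "homogeneous p e" shows "d = e"
  using assms component_homogeneous[of p d d] component_homogeneous[of p e d] by metis

lemma homogeneous_single: "homogeneous (Poly_Mapping.single m c) (tdeg m)"
  by (simp add: homogeneous_def)

text \<open>Multiplication by \<open>g\<close> shifts the tridegree of every term by
  \<open>e\<close>, so only the terms of \<open>h\<close> of tridegree \<open>d\<close> reach
  \<open>d + e\<close>.\<close>

lemma component_mult:
  assumes "homogeneous g e" shows "component (d + e) (h * g) = component d h * g"
proof (induction h rule: poly_mapping_induct)
  case (single m c)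
  show ?case
    by (simp add: component_homogeneous[OF homogeneous_single]
        component_homogeneous[OF homogeneous_mult[OF homogeneous_single assms]])
qed (simp add: component_add distrib_right)

lemma component_mult_0:
  assumes "homogeneous g e" "\<not> le3 e d" shows "component d (h * g) = 0"
proof (induction h rule: poly_mapping_induct)
  case (single m c)
  have "d \<noteq> tdeg m + e" using assms(2) le3_iff by blast
  then show ?case
    by (simp add: component_homogeneous[OF homogeneous_mult[OF homogeneous_single assms(1)]])
qed (simp add: component_add distrib_right)

lemma component_0_eq_pconst: "component 0 h = pconst (Poly_Mapping.lookup h 0)"
  by (rule poly_mapping_eqI)
    (auto simp: lookup_component pconst_def lookup_single tdeg_eq_0_iff when_def)

section \<open>Ideals generated in an antichain of tridegrees\<close>

lemma component_ideal_gen: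
  assumes hom: "\<And>t. t \<in> S \<Longrightarrow> homogeneous (M t) t"
    and p: "p \<in> ideal_gen (M ` S)" "component d p \<noteq> 0"
  shows "\<exists>t\<in>S. le3 t d"
proof (rule ccontr)
  assume *: "\<not> (\<exists>t\<in>S. le3 t d)"
  obtain F c where F: "F \<subseteq> M ` S" "p = (\<Sum>g\<in>F. c g * g)"
    using p(1) unfolding ideal_gen_def by blast
  have "component d (c g * g) = 0" if "g \<in> F" for g
    using that F(1) * hom component_mult_0 by blast
  then show False using p(2) F(2) by (simp add: component_sum)
qed

text \<open>No other member of the antichain lies below \<open>t\<close>, so only \<open>M t\<close>
  contributes in tridegree \<open>t\<close>, and its cofactor enters through the constant term
  alone.\<close>

lemma antichain_component:
  assumes hom: "\<And>t. t \<in> S \<Longrightarrow> homogeneous (M t) t"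
    and anti: "\<And>t t'. t \<in> S \<Longrightarrow> t' \<in> S \<Longrightarrow> le3 t t' \<Longrightarrow> t = t'"
    and p: "p \<in> ideal_gen (M ` S)" and t: "t \<in> S"
  shows "\<exists>c. component t p = pconst c * M t"
proof -
  obtain F c where F: "finite F" "F \<subseteq> M ` S" "p = (\<Sum>g\<in>F. c g * g)"
    using p unfolding ideal_gen_def by blast
  have other: "component t (c g * g) = 0" if "g \<in> F" "g \<noteq> M t" for g
    using that F(2) t hom anti component_mult_0 by blast
  have "component (0 + t) (c (M t) * M t) = component 0 (c (M t)) * M t"
    by (rule component_mult) (rule hom[OF t])
  then have M: "component t (c (M t) * M t) = pconst (Poly_Mapping.lookup (c (M t)) 0) * M t"
    by (simp add: component_0_eq_pconst)
  have "component t p = (\<Sum>g\<in>F. component t (c g * g))" by (simp add: F(3) component_sum)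
  also have "\<dots> = (\<Sum>g\<in>F. if g = M t then component t (c g * g) else 0)"
    by (rule sum.cong) (auto simp: other)
  also have "\<dots> = (if M t \<in> F then component t (c (M t) * M t) else 0)"
    using F(1) by simp
  also have "\<dots> = pconst (if M t \<in> F then Poly_Mapping.lookup (c (M t)) 0 else 0) * M t"
    by (simp add: M)
  finally show ?thesis by blast
qed

text \<open>An omitted generator would have to be produced by generators of tridegree at most its
  own, and in an antichain there is no other such tridegree.\<close>

lemma antichain_min_gens:
  assumes hom: "\<And>t. t \<in> S \<Longrightarrow> homogeneous (M t) t"
    and nz: "\<And>t. t \<in> S \<Longrightarrow> M t \<noteq> 0"
    and anti: "\<And>t t'. t \<in> S \<Longrightarrow> t' \<in> S \<Longrightarrow> le3 t t' \<Longrightarrow> t = t'"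
  shows "min_gens (ideal_gen (M ` S)) (M ` S)"
  unfolding min_gens_def
proof (intro conjI allI impI notI)
  fix H assume H: "H \<subset> M ` S" "ideal_gen H = ideal_gen (M ` S)"
  then obtain t where t: "t \<in> S" "M t \<notin> H" by blast
  define S' where "S' = {t \<in> S. M t \<in> H}"
  have "H = M ` S'" using H(1) by (auto simp: S'_def)
  then have "M t \<in> ideal_gen (M ` S')"
    using H(2) t(1) ideal_gen_base[of "M t" "M ` S"] by auto
  moreover have "component t (M t) \<noteq> 0"
    using component_homogeneous[OF hom[OF t(1)]] nz[OF t(1)] by simp
  ultimately have "\<exists>t'\<in>S'. le3 t' t"
    by (intro component_ideal_gen) (auto simp: S'_def hom)
  then show False using anti[OF _ t(1)] t(2) unfolding S'_def by blast
qed simp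

text \<open>Any minimal homogeneous generating set \<open>G\<close> contains a scalar multiple of
  each \<open>M t\<close>. These multiples already generate the ideal, so by minimality they exhaust
  \<open>G\<close>.\<close>

lemma antichain_gen_degrees:
  fixes M :: "nat \<times> nat \<times> nat \<Rightarrow> 'k::field mpoly"
  assumes hom: "\<And>t. t \<in> S \<Longrightarrow> homogeneous (M t) t"
    and nz: "\<And>t. t \<in> S \<Longrightarrow> M t \<noteq> 0"
    and anti: "\<And>t t'. t \<in> S \<Longrightarrow> t' \<in> S \<Longrightarrow> le3 t t' \<Longrightarrow> t = t'"
  shows "gen_degrees (ideal_gen (M ` S)) = S"
proof (intro equalityI subsetI)
  fix d assume "d \<in> S"
  moreover have "min_hom_gens (ideal_gen (M ` S)) (M ` S)"
    unfolding min_hom_gens_def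
    by (intro conjI antichain_min_gens ballI) (use assms in blast)+
  ultimately show "d \<in> gen_degrees (ideal_gen (M ` S))"
    using hom nz unfolding gen_degrees_def by blast
next
  fix d assume "d \<in> gen_degrees (ideal_gen (M ` S))"
  then obtain G g where G: "min_hom_gens (ideal_gen (M ` S)) G"
    and g: "g \<in> G" "g \<noteq> 0" "homogeneous g d"
    by (auto simp: gen_degrees_def)
  have gen: "ideal_gen G = ideal_gen (M ` S)"
    and irr: "H \<subset> G \<Longrightarrow> ideal_gen H \<noteq> ideal_gen (M ` S)"
    and homG: "h \<in> G \<Longrightarrow> \<exists>e. homogeneous h e" for H h
    using G by (auto simp: min_hom_gens_def min_gens_def)
  have ex: "\<exists>h\<in>G. homogeneous h t \<and> h dvd M t" if t: "t \<in> S" for t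
  proof -
    have "M t \<in> ideal_gen G" using gen t ideal_gen_base[of "M t" "M ` S"] by auto
    then obtain F c where F: "F \<subseteq> G" "M t = (\<Sum>h\<in>F. c h * h)"
      unfolding ideal_gen_def by blast
    have "(\<Sum>h\<in>F. component t (c h * h)) = component t (M t)"
      unfolding F(2) component_sum ..
    also have "\<dots> = M t" by (simp add: component_homogeneous[OF hom[OF t]])
    finally have "(\<Sum>h\<in>F. component t (c h * h)) \<noteq> 0" using nz[OF t] by simp
    then obtain h where h: "h \<in> F" "component t (c h * h) \<noteq> 0"
      by (rule sum.not_neutral_contains_not_neutral)
    then obtain e where e: "homogeneous h e" using F(1) homG by blast
    have le: "le3 e t" using h(2) component_mult_0[OF e] by blast
    have hI: "h \<in> ideal_gen (M ` S)" using F(1) h(1) gen ideal_gen_base by blast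
    have h0: "h \<noteq> 0" using h(2) by auto
    then obtain t' where t': "t' \<in> S" "le3 t' e"
      using component_ideal_gen[OF hom hI, of e] component_homogeneous[OF e] by auto
    \<comment> \<open>The chain \<open>t' \<le> e \<le> t\<close> with both ends in the antichain
      collapses, so \<open>h\<close> has tridegree exactly \<open>t\<close>.\<close>
    then have "t' = t" using anti[OF t'(1) t] le3_trans le by blast
    then have et: "e = t" using t'(2) le le3_antisym by blast
    obtain k where k: "h = pconst k * M t"
      using antichain_component[OF hom anti hI t] component_homogeneous[OF e] et by auto
    then have "k \<noteq> 0" using h0 by auto
    then have "M t = pconst (1 / k) * h"
      by (simp add: k flip: mult.assoc pconst_mult)
    then show ?thesis using e et h(1) F(1) by (metis dvd_triv_right subsetD)
  qed
  define h where "h t = (SOME h. h \<in> G \<and> homogeneous h t \<and> h dvd M t)" for t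
  have h: "h t \<in> G" "homogeneous (h t) t" "h t dvd M t" if "t \<in> S" for t
    using someI_ex[OF ex[OF that, unfolded Bex_def]] by (auto simp: h_def)
  have "ideal_gen (M ` S) \<subseteq> ideal_gen (h ` S)"
    by (rule ideal_gen_subsetI) (auto intro: ideal_gen_dvd[OF ideal_gen_base h(3)])
  moreover have "h ` S \<subseteq> G" using h(1) by auto
  moreover have "ideal_gen (h ` S) \<subseteq> ideal_gen G" using h(1) by (intro ideal_gen_mono) auto
  ultimately have "h ` S = G" using irr[of "h ` S"] gen by blast
  then obtain t where "t \<in> S" "g = h t" using g(1) by blast
  then show "d \<in> S" using h(2) homogeneous_unique[OF g(2,3)] by blast
qed

section \<open>Ferrers configurations of linear forms\<close>

definition row_prod :: "(nat \<Rightarrow> 'a::comm_monoid_mult) \<Rightarrow> nat \<Rightarrow> 'a" where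
  "row_prod A n = (\<Prod>i\<in>{1..n}. A i)"

lemma row_prod_Suc: "row_prod A (Suc n) = row_prod A n * A (Suc n)"
  by (simp add: row_prod_def mult.commute)

lemma row_prod_0 [simp]: "row_prod A 0 = 1"
  by (simp add: row_prod_def)

lemma dvd_row_prod: "1 \<le> i \<Longrightarrow> i \<le> n \<Longrightarrow> (A i :: 'a::comm_semiring_1) dvd row_prod A n"
  unfolding row_prod_def by (rule dvd_prodI) auto

lemma row_prod_dvd_mono: "m \<le> n \<Longrightarrow> (row_prod A m :: 'a::comm_semiring_1) dvd row_prod A n"
  unfolding row_prod_def by (rule prod_dvd_prod_subset) auto

lemma down_closedD:
  "down_closed U \<Longrightarrow> (u, v) \<in> U \<Longrightarrow> 1 \<le> u' \<Longrightarrow> u' \<le> u \<Longrightarrow> 1 \<le> v' \<Longrightarrow> v' \<le> v \<Longrightarrow> (u', v') \<in> U"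
  unfolding down_closed_def by blast

text \<open>Boundedness gives a last column in the row and downward closure fills in all columns
  before it; an empty row gets length 0.\<close>

lemma down_closed_row:
  assumes "down_closed U" "U \<subseteq> {1..p} \<times> {1..q}"
  obtains b where "b \<le> q" "\<And>j. (Suc n, j) \<in> U \<longleftrightarrow> 1 \<le> j \<and> j \<le> b"
proof (cases "\<exists>j. (Suc n, j) \<in> U")
  case False
  then show ?thesis using that[of 0] by auto
next
  case True
  define b where "b = Max {j. (Suc n, j) \<in> U}"
  have fin: "finite {j. (Suc n, j) \<in> U}"
    by (rule finite_subset[of _ "{1..q}"]) (use assms(2) in auto)
  then have b: "(Suc n, b) \<in> U" "\<And>j. (Suc n, j) \<in> U \<Longrightarrow> j \<le> b"
    using Max_in[OF fin] True unfolding b_def by (auto intro: Max_ge[OF fin])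
  show ?thesis
  proof (rule that)
    show "b \<le> q" using b(1) assms(2) by auto
    show "(Suc n, j) \<in> U \<longleftrightarrow> 1 \<le> j \<and> j \<le> b" for j
      using b(2)[of j] down_closedD[OF assms(1) b(1), of "Suc n" j] assms(2) by auto
  qed
qed

text \<open>For a downward closed \<open>U\<close>, \<open>(a + 1, b + 1) \<notin> U\<close> means that every \<open>(i, j) \<in> U\<close> has
  \<open>i \<le> a\<close> or \<open>j \<le> b\<close>.\<close>

definition gen_exponents ::
  "nat \<Rightarrow> nat \<Rightarrow> nat \<Rightarrow> (nat \<times> nat) set \<Rightarrow> (nat \<times> nat) set \<Rightarrow> (nat \<times> nat) set \<Rightarrow> (nat \<times> nat \<times> nat) set"
  where "gen_exponents p q r U3 U2 U1 = {(a, b, c). a \<le> p \<and> b \<le> q \<and> c \<le> r \<and>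
     (Suc a, Suc b) \<notin> U3 \<and> (Suc a, Suc c) \<notin> U2 \<and> (Suc b, Suc c) \<notin> U1}"

lemma mem_I3: "h \<in> I3 A B U \<longleftrightarrow> (\<forall>i j. (i, j) \<in> U \<longrightarrow> h \<in> ideal_gen {A i, B j})"
  by (auto simp: I3_def)

text \<open>One family indexed by the factor replaces the three families A, B, C, so that facts
  about two factors are proved once for every choice of the pair.\<close>

locale independent_forms =
  fixes L :: "fac \<Rightarrow> nat \<Rightarrow> 'k::field mpoly" and d :: "fac \<Rightarrow> nat"
  assumes linear: "1 \<le> i \<Longrightarrow> i \<le> d f \<Longrightarrow> linear_form f (L f i)"
    and indep: "1 \<le> i \<Longrightarrow> i \<le> d f \<Longrightarrow> 1 \<le> j \<Longrightarrow> j \<le> d f \<Longrightarrow> i \<noteq> j \<Longrightarrow> L f i \<noteq> pconst c * L f j"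
begin

lemma form_neq_0:
  assumes "1 \<le> i" "i \<le> d f" shows "L f i \<noteq> 0"
proof
  assume 0: "L f i = 0"
  obtain \<alpha> \<beta> where ab: "(\<alpha>, \<beta>) \<noteq> (0, 0)"
    "L f i = pconst \<alpha> * pvar (Var f False) + pconst \<beta> * pvar (Var f True)"
    using linear[OF assms] unfolding linear_form_def by blast
  have [simp]: "Poly_Mapping.single (Var f False) (Suc 0) \<noteq> Poly_Mapping.single (Var f True) (Suc 0)"
    by (metis lookup_single_eq lookup_single_not_eq nat.distinct(1) var.inject)
  note this[symmetric, simp]
  have "Poly_Mapping.lookup (L f i) (Poly_Mapping.single (Var f False) 1) = \<alpha>"
    "Poly_Mapping.lookup (L f i) (Poly_Mapping.single (Var f True) 1) = \<beta>"
    by (auto simp: ab(2) pconst_def pvar_def mult_single lookup_add lookup_single when_def)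
  then show False using 0 ab(1) by simp
qed

lemma obtain_retraction:
  assumes "1 \<le> i" "i \<le> d f"
  obtains \<phi> where "retraction (L f i) \<phi>"
    and "\<And>g j. 1 \<le> j \<Longrightarrow> j \<le> d g \<Longrightarrow> g \<noteq> f \<Longrightarrow> \<phi> (L g j) = L g j"
    and "\<And>j. 1 \<le> j \<Longrightarrow> j \<le> d f \<Longrightarrow> j \<noteq> i \<Longrightarrow> \<phi> (L f j) \<noteq> 0"
proof -
  obtain \<phi> where \<phi>: "retraction (L f i) \<phi>"
    "\<And>g M. linear_form g M \<Longrightarrow> g \<noteq> f \<Longrightarrow> \<phi> M = M"
    "\<And>M. linear_form f M \<Longrightarrow> \<phi> M = 0 \<Longrightarrow> \<exists>c. M = pconst c * L f i"
    using linear_form_retraction[OF linear[OF assms]] by metis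
  show ?thesis
  proof (rule that[OF \<phi>(1)])
    show "\<phi> (L g j) = L g j" if "1 \<le> j" "j \<le> d g" "g \<noteq> f" for g j
      using \<phi>(2)[OF linear[OF that(1,2)] that(3)] .
    show "\<phi> (L f j) \<noteq> 0" if "1 \<le> j" "j \<le> d f" "j \<noteq> i" for j
      using \<phi>(3)[OF linear[OF that(1,2)]] indep[OF that(1,2) assms that(3)] by blast
  qed
qed

section \<open>Primality of the forms and cancellation modulo pairs\<close>

text \<open>The retraction of \<open>L f i\<close> fixes the forms of other factors, which are
  nonzero, and kills a form of the same factor only if it is proportional to
  \<open>L f i\<close>.\<close>

lemma not_dvd:
  assumes "1 \<le> i" "i \<le> d f" "1 \<le> j" "j \<le> d g" "(f, i) \<noteq> (g, j)"
  shows "\<not> L f i dvd L g j"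
proof -
  obtain \<phi> where \<phi>: "retraction (L f i) \<phi>"
    and "\<And>g j. 1 \<le> j \<Longrightarrow> j \<le> d g \<Longrightarrow> g \<noteq> f \<Longrightarrow> \<phi> (L g j) = L g j"
    and "\<And>j. 1 \<le> j \<Longrightarrow> j \<le> d f \<Longrightarrow> j \<noteq> i \<Longrightarrow> \<phi> (L f j) \<noteq> 0"
    using obtain_retraction[OF assms(1,2)] by blast
  then show ?thesis
    using assms(3-) form_neq_0[OF assms(3,4)] by (cases "g = f") (auto simp flip: retraction_eq_0_iff[OF \<phi>])
qed

text \<open>The retraction takes values in a domain and does not kill \<open>L g j\<close>, so it
  has to kill \<open>h\<close>.\<close>

lemma dvd_cancel:
  assumes "1 \<le> i" "i \<le> d f" "1 \<le> j" "j \<le> d g" "(f, i) \<noteq> (g, j)" "L f i dvd L g j * h"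
  shows "L f i dvd h"
proof -
  obtain \<phi> where \<phi>: "retraction (L f i) \<phi>" using obtain_retraction[OF assms(1,2)] .
  have "\<phi> (L g j) * \<phi> h = 0"
    using \<phi> retraction_eq_0_iff[OF \<phi>, of "L g j * h"] assms(6) by (simp add: retraction_def)
  then show ?thesis
    using retraction_eq_0_iff[OF \<phi>] not_dvd[OF assms(1-5)] by auto
qed

text \<open>The pair ideal is the kernel of \<open>\<psi>\<close> after \<open>\<phi>\<close>, a
  multiplicative map into a domain. As \<open>e \<noteq> f\<close>, the form \<open>L e k\<close> is
  fixed by \<open>\<phi>\<close>, and \<open>\<psi>\<close> does not kill it.\<close>

lemma pair_cancel_aux:
  assumes i: "1 \<le> i" "i \<le> d f" and j: "1 \<le> j" "j \<le> d g" and k: "1 \<le> k" "k \<le> d e"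
    and "f \<noteq> g" "e \<noteq> f" "(e, k) \<noteq> (g, j)"
    and h: "L e k * h \<in> ideal_gen {L f i, L g j}"
  shows "h \<in> ideal_gen {L f i, L g j}"
proof -
  obtain \<phi> where \<phi>: "retraction (L f i) \<phi>"
    "\<And>g j. 1 \<le> j \<Longrightarrow> j \<le> d g \<Longrightarrow> g \<noteq> f \<Longrightarrow> \<phi> (L g j) = L g j"
    using obtain_retraction[OF i] by metis
  obtain \<psi> where \<psi>: "retraction (L g j) \<psi>" using obtain_retraction[OF j] .
  note iff = retraction_pair_iff[OF \<phi>(1) \<psi> \<phi>(2)[OF j not_sym[OF \<open>f \<noteq> g\<close>]]]
  have "\<psi> (L e k) * \<psi> (\<phi> h) = 0"
    using h \<phi>(1) \<psi> \<phi>(2)[OF k \<open>e \<noteq> f\<close>] by (simp add: iff retraction_def)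
  moreover have "\<psi> (L e k) \<noteq> 0"
    using not_dvd[OF j k] assms(9) by (auto simp: retraction_eq_0_iff[OF \<psi>])
  ultimately show ?thesis by (simp add: iff)
qed

text \<open>If \<open>e = f\<close>, then \<open>e \<noteq> g\<close>, and exchanging the two forms
  of the pair leads back to the previous lemma.\<close>

lemma pair_cancel:
  assumes "1 \<le> i" "i \<le> d f" "1 \<le> j" "j \<le> d g" "1 \<le> k" "k \<le> d e"
    and "f \<noteq> g" "(e, k) \<noteq> (f, i)" "(e, k) \<noteq> (g, j)"
    and h: "L e k * h \<in> ideal_gen {L f i, L g j}"
  shows "h \<in> ideal_gen {L f i, L g j}"
proof (cases "e = f")
  case False
  then show ?thesis using pair_cancel_aux[OF assms(1-7) _ assms(9,10)] by blast
next
  case True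
  then show ?thesis
    using pair_cancel_aux[OF assms(3,4,1,2,5,6), of h] assms(7-) by (auto simp: insert_commute)
qed

text \<open>The condition \<open>g \<noteq> f \<or> n < i\<close> keeps \<open>L f i\<close> out of
  the product, so its forms can be cancelled one at a time.\<close>

lemma dvd_row_prod_cancel:
  assumes "1 \<le> i" "i \<le> d f" "n \<le> d g" "g \<noteq> f \<or> n < i" "L f i dvd row_prod (L g) n * h"
  shows "L f i dvd h"
  using assms(3-)
proof (induction n arbitrary: h)
  case (Suc n)
  have "L f i dvd row_prod (L g) n * (L g (Suc n) * h)"
    using Suc.prems(3) by (simp add: row_prod_Suc mult.assoc)
  then have *: "L f i dvd L g (Suc n) * h"
    by (rule Suc.IH[rotated -1]) (use Suc.prems(1,2) in auto)
  show ?case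
    by (rule dvd_cancel[OF assms(1,2) _ Suc.prems(1) _ *]) (use Suc.prems(2) in auto)
qed simp

lemma pair_row_prod_cancel:
  assumes "1 \<le> i" "i \<le> d f" "1 \<le> j" "j \<le> d g" "f \<noteq> g" "n \<le> d e" "e = f \<longrightarrow> n < i" "e = g \<longrightarrow> n < j"
    "row_prod (L e) n * h \<in> ideal_gen {L f i, L g j}"
  shows "h \<in> ideal_gen {L f i, L g j}"
  using assms(6-)
proof (induction n arbitrary: h)
  case (Suc n)
  have "row_prod (L e) n * (L e (Suc n) * h) \<in> ideal_gen {L f i, L g j}"
    using Suc.prems(4) by (simp add: row_prod_Suc mult.assoc)
  then have *: "L e (Suc n) * h \<in> ideal_gen {L f i, L g j}"
    by (rule Suc.IH[rotated -1]) (use Suc.prems(1-3) in auto)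
  show ?case
    by (rule pair_cancel[OF assms(1-4) _ Suc.prems(1) assms(5) _ _ *]) (use Suc.prems(2,3) in auto)
qed simp

text \<open>The next form does not occur in the product split off so far, so it divides the
  cofactor.\<close>

lemma row_prod_dvd:
  assumes "n \<le> d f" "\<And>i. 1 \<le> i \<Longrightarrow> i \<le> n \<Longrightarrow> L f i dvd h"
  shows "row_prod (L f) n dvd h"
  using assms
proof (induction n)
  case 0
  show ?case unfolding row_prod_0 by (rule one_dvd)
next
  case (Suc n)
  have "row_prod (L f) n dvd h"
    by (rule Suc.IH) (rule Suc_leD[OF Suc.prems(1)], rule Suc.prems(2), auto)
  then obtain k where k: "h = row_prod (L f) n * k" by (rule dvdE)
  have "L f (Suc n) dvd row_prod (L f) n * k"
    using Suc.prems(2)[of "Suc n"] unfolding k by linarith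
  then have "L f (Suc n) dvd k"
    using Suc.prems(1) dvd_row_prod_cancel[of "Suc n" f n f k] by linarith
  then show ?case unfolding k row_prod_Suc by (rule mult_dvd_mono[OF dvd_refl])
qed

text \<open>The stripping argument for two factors. The bounds \<open>b0\<close> and
  \<open>c0\<close> record forms known to divide \<open>h\<close>; in the three-factor argument they
  come from a row of each of the other two diagrams.\<close>

lemma plane_gens:
  assumes fg: "f \<noteq> g" and U: "down_closed U" "U \<subseteq> {1..d f} \<times> {1..d g}"
    and bounds: "b0 \<le> d f" "c0 \<le> d g"
    and hf: "\<And>j. 1 \<le> j \<Longrightarrow> j \<le> b0 \<Longrightarrow> L f j dvd h"
    and hg: "\<And>k. 1 \<le> k \<Longrightarrow> k \<le> c0 \<Longrightarrow> L g k dvd h"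
    and hU: "\<And>j k. (j, k) \<in> U \<Longrightarrow> h \<in> ideal_gen {L f j, L g k}"
  shows "h \<in> ideal_gen {row_prod (L f) b * row_prod (L g) c | b c.
           b0 \<le> b \<and> b \<le> d f \<and> c0 \<le> c \<and> c \<le> d g \<and> (Suc b, Suc c) \<notin> U}"
    (is "h \<in> ideal_gen ?G")
proof -
  \<comment> \<open>Here \<open>b\<close> counts the forms of factor \<open>f\<close> already split
    off; the induction runs over the number still left, with \<open>h\<close> varying.\<close>
  have "h \<in> ideal_gen ?G" if "b0 \<le> b" "b \<le> d f" "row_prod (L f) b dvd h"
    and "\<And>k. 1 \<le> k \<Longrightarrow> k \<le> c0 \<Longrightarrow> L g k dvd h"
    and "\<And>j k. (j, k) \<in> U \<Longrightarrow> h \<in> ideal_gen {L f j, L g k}" for b h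
    using that
  proof (induction "d f - b" arbitrary: b h)
    case 0
    obtain q where q: "h = row_prod (L f) b * q" using 0(4) by (rule dvdE)
    have b: "b = d f" using 0(1,3) by simp
    have "row_prod (L g) c0 dvd q"
    proof (rule row_prod_dvd[OF bounds(2)])
      fix k assume k: "1 \<le> k" "k \<le> c0"
      show "L g k dvd q"
        using dvd_row_prod_cancel[OF k(1) order_trans[OF k(2) bounds(2)] 0(3) disjI1[OF fg]]
          0(5)[OF k] unfolding q .
    qed
    then have "row_prod (L f) b * row_prod (L g) c0 dvd h" by (simp add: q)
    \<comment> \<open>No row of \<open>U\<close> has index \<open>d f + 1\<close>, so
      \<open>c0\<close> is admissible once all forms of factor \<open>f\<close> are split
      off.\<close>
    moreover have "row_prod (L f) b * row_prod (L g) c0 \<in> ?G"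
      using b bounds U(2) by force
    ultimately show ?case by (blast intro: ideal_gen_dvd ideal_gen_base)
  next
    case (Suc n)
    have b: "Suc b \<le> d f" using Suc.hyps(2) by simp
    obtain q where q: "h = row_prod (L f) b * q" using Suc.prems(3) by (rule dvdE)
    obtain \<phi> where \<phi>: "retraction (L f (Suc b)) \<phi>"
      "\<And>g j. 1 \<le> j \<Longrightarrow> j \<le> d g \<Longrightarrow> g \<noteq> f \<Longrightarrow> \<phi> (L g j) = L g j"
      using obtain_retraction[OF _ b] by (metis le_add1 plus_1_eq_Suc)
    have \<phi>_dvd: "L g k dvd \<phi> p" if "1 \<le> k" "k \<le> d g" "L g k dvd p" for k p
      using that \<phi> fg by (auto simp: retraction_def dvd_def)
    obtain c1 where c1: "c1 \<le> d g" "\<And>k. (Suc b, k) \<in> U \<longleftrightarrow> 1 \<le> k \<and> k \<le> c1"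
      using down_closed_row[OF U, where n = b] by blast
    \<comment> \<open>The first \<open>c0\<close> forms divide \<open>\<phi> q\<close> by
      assumption, the first \<open>c1\<close> because of row \<open>b + 1\<close> of
      \<open>U\<close>; moreover \<open>c1 \<le> c\<close> puts \<open>(Suc b, Suc c)\<close>
      outside \<open>U\<close>.\<close>
    define c where "c = max c0 c1"
    have c: "c0 \<le> c" "c1 \<le> c" "c \<le> d g" using bounds c1(1) by (auto simp: c_def)
    have g_dvd: "L g k dvd \<phi> q" if k: "1 \<le> k" "k \<le> c" for k
    proof (cases "k \<le> c0")
      case True
      have "k \<le> d g" using k c by simp
      moreover from this have "L g k dvd q"
        using dvd_row_prod_cancel[OF k(1) _ Suc.prems(2) disjI1[OF fg]] Suc.prems(4)[OF k(1) True]
        unfolding q by blast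
      ultimately show ?thesis using \<phi>_dvd[OF k(1)] by blast
    next
      case False
      then have kU: "(Suc b, k) \<in> U" using k by (simp add: c1 c_def)
      have "q \<in> ideal_gen {L f (Suc b), L g k}"
        by (rule pair_row_prod_cancel[of "Suc b" f k g b f])
          (use b c k fg Suc.prems(5)[OF kU] in \<open>simp_all add: q\<close>)
      then obtain u v where "q = u * L f (Suc b) + v * L g k" by (auto simp: ideal_gen_pair)
      then have "\<phi> q = \<phi> v * L g k"
        using \<phi>(1) \<phi>(2)[of k g] k c fg by (auto simp: retraction_def)
      then show ?thesis by simp
    qed
    then have "row_prod (L g) c dvd \<phi> q" using row_prod_dvd c(3) by blast
    then have "row_prod (L f) b * row_prod (L g) c dvd row_prod (L f) b * \<phi> q" by simp
    moreover have "row_prod (L f) b * row_prod (L g) c \<in> ?G"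
      using c Suc.prems(1,2) c1(2)[of "Suc c"] by force
    ultimately have rem: "row_prod (L f) b * \<phi> q \<in> ideal_gen ?G"
      by (blast intro: ideal_gen_dvd ideal_gen_base)
    obtain q' where q': "q - \<phi> q = L f (Suc b) * q'"
      using \<phi>(1) by (metis retraction_def dvd_def)
    \<comment> \<open>Subtracting the remainder gains one more form of factor \<open>f\<close>,
      which drives the induction.\<close>
    have h: "h - row_prod (L f) b * \<phi> q = row_prod (L f) (Suc b) * q'"
      using q' by (simp add: q row_prod_Suc mult.assoc flip: right_diff_distrib)
    have "h - row_prod (L f) b * \<phi> q \<in> ideal_gen ?G"
    proof (rule Suc.hyps(1)[of "Suc b"])
      show "L g k dvd h - row_prod (L f) b * \<phi> q" if "1 \<le> k" "k \<le> c0" for k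
        using Suc.prems(4)[OF that] g_dvd[of k] that c(1) by auto
      show "h - row_prod (L f) b * \<phi> q \<in> ideal_gen {L f j, L g k}" if jk: "(j, k) \<in> U" for j k
      proof (rule ideal_gen_diff[OF Suc.prems(5)[OF jk]])
        \<comment> \<open>The subtracted term must satisfy the same conditions as \<open>h\<close>:
          up to row \<open>b\<close> a form in the product helps, and later rows are no longer than
          row \<open>b + 1\<close>, whose forms divide \<open>\<phi> q\<close>.\<close>
        have "L f j dvd row_prod (L f) b * \<phi> q \<or> L g k dvd row_prod (L f) b * \<phi> q"
        proof (cases "j \<le> b")
          case True
          then show ?thesis using jk U(2) dvd_row_prod[of j b "L f"] by auto
        next
          case False
          then have "(Suc b, k) \<in> U"
            using jk U(2) by (intro down_closedD[OF U(1) jk]) auto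
          then show ?thesis using c1 c g_dvd[of k] by auto
        qed
        then show "row_prod (L f) b * \<phi> q \<in> ideal_gen {L f j, L g k}"
          by (blast intro: ideal_gen_dvd ideal_gen_base)
      qed
    qed (use Suc.hyps(2) Suc.prems(1) b h in auto)
    then show ?case using ideal_gen_add[OF _ rem] by fastforce
  qed
  then show ?thesis
    using bounds row_prod_dvd[OF bounds(1) hf] hg hU by blast
qed

end

section \<open>The ideal of a configuration in three factors\<close>

definition staircase_form ::
  "(nat \<Rightarrow> 'k::comm_ring_1 mpoly) \<Rightarrow> (nat \<Rightarrow> 'k mpoly) \<Rightarrow> (nat \<Rightarrow> 'k mpoly) \<Rightarrow> nat \<times> nat \<times> nat \<Rightarrow> 'k mpoly"
  where "staircase_form A B C = (\<lambda>(a, b, c). row_prod A a * row_prod B b * row_prod C c)"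

text \<open>An \<open>(i, j)\<close> in \<open>U\<close> beyond both \<open>a\<close> and
  \<open>b\<close> would force \<open>(Suc a, Suc b)\<close> into \<open>U\<close>; hence
  \<open>A i\<close> or \<open>B j\<close> always divides \<open>h\<close>.\<close>

lemma staircase_form_mem_I3:
  assumes "down_closed U" "U \<subseteq> {1..p} \<times> {1..q}" "(Suc a, Suc b) \<notin> U"
    and "row_prod A a dvd h" "row_prod B b dvd h"
  shows "h \<in> I3 A B U"
  unfolding mem_I3
proof (intro allI impI)
  fix i j assume ij: "(i, j) \<in> U"
  then have 1: "1 \<le> i" "1 \<le> j" using assms(2) by auto
  have "i \<le> a \<or> j \<le> b"
    using down_closedD[OF assms(1) ij, of "Suc a" "Suc b"] assms(3) by fastforce
  then have "A i dvd h \<or> B j dvd h"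
    using dvd_row_prod[OF 1(1)] dvd_row_prod[OF 1(2)] assms(4,5) dvd_trans by blast
  then show "h \<in> ideal_gen {A i, B j}"
    by (blast intro: ideal_gen_dvd ideal_gen_base)
qed

context independent_forms begin

context
  fixes U3 U2 U1 :: "(nat \<times> nat) set"
  assumes U3: "down_closed U3" "U3 \<subseteq> {1..d F1} \<times> {1..d F2}"
    and U2: "down_closed U2" "U2 \<subseteq> {1..d F1} \<times> {1..d F3}"
    and U1: "down_closed U1" "U1 \<subseteq> {1..d F2} \<times> {1..d F3}"
begin

abbreviation "lines_ideal \<equiv> I3 (L F1) (L F2) U3 \<inter> I3 (L F1) (L F3) U2 \<inter> I3 (L F2) (L F3) U1"

abbreviation "gen_forms \<equiv> staircase_form (L F1) (L F2) (L F3) ` gen_exponents (d F1) (d F2) (d F3) U3 U2 U1"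

lemma gen_forms_subset: "ideal_gen gen_forms \<subseteq> lines_ideal"
proof
  fix h assume h: "h \<in> ideal_gen gen_forms"
  have "g \<in> lines_ideal" if "g \<in> gen_forms" for g
  proof -
    obtain a b c where abc: "(a, b, c) \<in> gen_exponents (d F1) (d F2) (d F3) U3 U2 U1"
      "g = row_prod (L F1) a * row_prod (L F2) b * row_prod (L F3) c"
      using \<open>g \<in> gen_forms\<close> by (auto simp: staircase_form_def)
    then show ?thesis
      using staircase_form_mem_I3[OF U3, of a b "L F1" g "L F2"]
        staircase_form_mem_I3[OF U2, of a c "L F1" g "L F3"]
        staircase_form_mem_I3[OF U1, of b c "L F2" g "L F3"]
      by (auto simp: gen_exponents_def)
  qed
  then have gen: "g \<in> I3 (L F1) (L F2) U3" "g \<in> I3 (L F1) (L F3) U2" "g \<in> I3 (L F2) (L F3) U1"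
    if "g \<in> gen_forms" for g using that by blast+
  show "h \<in> lines_ideal"
  proof (intro IntI; unfold mem_I3; intro allI impI)
    show "h \<in> ideal_gen {L F1 i, L F2 j}" if "(i, j) \<in> U3" for i j
      using ideal_gen_subsetI[of gen_forms "{L F1 i, L F2 j}"] gen(1) that h
      unfolding mem_I3 by blast
    show "h \<in> ideal_gen {L F1 i, L F3 j}" if "(i, j) \<in> U2" for i j
      using ideal_gen_subsetI[of gen_forms "{L F1 i, L F3 j}"] gen(2) that h
      unfolding mem_I3 by blast
    show "h \<in> ideal_gen {L F2 i, L F3 j}" if "(i, j) \<in> U1" for i j
      using ideal_gen_subsetI[of gen_forms "{L F2 i, L F3 j}"] gen(3) that h
      unfolding mem_I3 by blast
  qed
qed

text \<open>Row \<open>n + 1\<close> of \<open>U3\<close> and of \<open>U2\<close> supplies the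
  bounds \<open>b0\<close> and \<open>c0\<close> for \<open>plane_gens\<close>. Then
  \<open>b0 \<le> b\<close> and \<open>c0 \<le> c\<close> are exactly the conditions that make
  \<open>(n, b, c)\<close> admissible for these two diagrams.\<close>

lemma remainder_mem_gen_forms:
  assumes n: "n \<le> d F1"
    and r3: "\<And>j. (Suc n, j) \<in> U3 \<Longrightarrow> L F2 j dvd r"
    and r2: "\<And>k. (Suc n, k) \<in> U2 \<Longrightarrow> L F3 k dvd r"
    and r1: "\<And>j k. (j, k) \<in> U1 \<Longrightarrow> r \<in> ideal_gen {L F2 j, L F3 k}"
  shows "row_prod (L F1) n * r \<in> ideal_gen gen_forms"
proof -
  obtain b0 where b0: "b0 \<le> d F2" "\<And>j. (Suc n, j) \<in> U3 \<longleftrightarrow> 1 \<le> j \<and> j \<le> b0"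
    using down_closed_row[OF U3, where n = n] by blast
  obtain c0 where c0: "c0 \<le> d F3" "\<And>k. (Suc n, k) \<in> U2 \<longleftrightarrow> 1 \<le> k \<and> k \<le> c0"
    using down_closed_row[OF U2, where n = n] by blast
  have "r \<in> ideal_gen {row_prod (L F2) b * row_prod (L F3) c | b c.
           b0 \<le> b \<and> b \<le> d F2 \<and> c0 \<le> c \<and> c \<le> d F3 \<and> (Suc b, Suc c) \<notin> U1}"
    by (rule plane_gens[OF _ U1 b0(1) c0(1)]) (use b0 c0 r3 r2 r1 in blast)+
  then show ?thesis
  proof (rule ideal_gen_mult_left)
    fix g assume "g \<in> {row_prod (L F2) b * row_prod (L F3) c | b c.
           b0 \<le> b \<and> b \<le> d F2 \<and> c0 \<le> c \<and> c \<le> d F3 \<and> (Suc b, Suc c) \<notin> U1}"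
    then obtain b c where g: "g = row_prod (L F2) b * row_prod (L F3) c"
      and bc: "b0 \<le> b" "b \<le> d F2" "c0 \<le> c" "c \<le> d F3" "(Suc b, Suc c) \<notin> U1" by blast
    have "(n, b, c) \<in> gen_exponents (d F1) (d F2) (d F3) U3 U2 U1"
      using n bc b0(2)[of "Suc b"] c0(2)[of "Suc c"] by (simp add: gen_exponents_def)
    moreover have "row_prod (L F1) n * g = staircase_form (L F1) (L F2) (L F3) (n, b, c)"
      by (simp add: g staircase_form_def mult.assoc)
    ultimately show "row_prod (L F1) n * g \<in> ideal_gen gen_forms"
      by (metis ideal_gen_base imageI)
  qed
qed

text \<open>The outer stripping, along the first factor: \<open>n\<close> counts the forms already
  split off, and the instance \<open>n = 0\<close> covers every element of the ideal.\<close>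

lemma lines_ideal_subset:
  assumes "n \<le> d F1" "row_prod (L F1) n dvd h" "h \<in> lines_ideal"
  shows "h \<in> ideal_gen gen_forms"
  using assms
proof (induction "d F1 - n" arbitrary: n h)
  case 0
  have n: "n = d F1" using 0(1,2) by simp
  obtain q where q: "h = row_prod (L F1) n * q" using 0(3) by (rule dvdE)
  show ?case unfolding q
  \<comment> \<open>Row \<open>d F1 + 1\<close> is empty in \<open>U3\<close> and \<open>U2\<close>,
    so only the conditions from \<open>U1\<close> remain, and the product cancels from them.\<close>
  proof (rule remainder_mem_gen_forms[OF 0(2)])
    fix j k assume jk: "(j, k) \<in> U1"
    then have "row_prod (L F1) n * q \<in> ideal_gen {L F2 j, L F3 k}"
      using 0(4) unfolding q mem_I3 Int_iff by blast
    then show "q \<in> ideal_gen {L F2 j, L F3 k}"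
      by (rule pair_row_prod_cancel[rotated -1]) (use jk U1(2) 0(2) in auto)
  qed (use n U3(2) U2(2) in auto)
next
  case (Suc m)
  have n: "Suc n \<le> d F1" using Suc.hyps(2) by simp
  obtain q where q: "h = row_prod (L F1) n * q" using Suc.prems(2) by (rule dvdE)
  obtain \<phi> where \<phi>: "retraction (L F1 (Suc n)) \<phi>"
    "\<And>g j. 1 \<le> j \<Longrightarrow> j \<le> d g \<Longrightarrow> g \<noteq> F1 \<Longrightarrow> \<phi> (L g j) = L g j"
    using obtain_retraction[OF _ n] by (metis le_add1 plus_1_eq_Suc)
  have \<phi>_hom: "\<phi> (x + y) = \<phi> x + \<phi> y" "\<phi> (x * y) = \<phi> x * \<phi> y" "\<phi> (L F1 (Suc n)) = 0" for x y
    using \<phi>(1) by (auto simp: retraction_def)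
  \<comment> \<open>After \<open>\<phi>\<close> has killed \<open>L F1 (Suc n)\<close>, membership
    in a pair ideal containing that form becomes divisibility by the other form.\<close>
  have row: "L g j dvd \<phi> q"
    if "g \<noteq> F1" "1 \<le> j" "j \<le> d g" "h \<in> ideal_gen {L F1 (Suc n), L g j}" for g j
  proof -
    have "q \<in> ideal_gen {L F1 (Suc n), L g j}"
      by (rule pair_row_prod_cancel[of "Suc n" F1 j g n F1]) (use that n in \<open>simp_all flip: q\<close>)
    then obtain u v where "q = u * L F1 (Suc n) + v * L g j" by (auto simp: ideal_gen_pair)
    then have "\<phi> q = \<phi> v * L g j" using that \<phi>(2) by (simp add: \<phi>_hom)
    then show ?thesis by simp
  qed
  have rem: "row_prod (L F1) n * \<phi> q \<in> ideal_gen gen_forms"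
  proof (rule remainder_mem_gen_forms[OF Suc.prems(1)])
    show "L F2 j dvd \<phi> q" if "(Suc n, j) \<in> U3" for j
      using that U3(2) Suc.prems(3) by (intro row) (auto simp: mem_I3)
    show "L F3 k dvd \<phi> q" if "(Suc n, k) \<in> U2" for k
      using that U2(2) Suc.prems(3) by (intro row) (auto simp: mem_I3)
    fix j k assume jk: "(j, k) \<in> U1"
    then have "row_prod (L F1) n * q \<in> ideal_gen {L F2 j, L F3 k}"
      using Suc.prems(3) unfolding q mem_I3 Int_iff by blast
    then have "q \<in> ideal_gen {L F2 j, L F3 k}"
      by (rule pair_row_prod_cancel[rotated -1]) (use jk U1(2) Suc.prems(1) in auto)
    then obtain u v where "q = u * L F2 j + v * L F3 k" by (auto simp: ideal_gen_pair)
    \<comment> \<open>The retraction fixes the forms of the second and third factor, so the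
      conditions from \<open>U1\<close> survive.\<close>
    then have "\<phi> q = \<phi> u * L F2 j + \<phi> v * L F3 k"
      using jk U1(2) \<phi>(2)[of j F2] \<phi>(2)[of k F3] by (auto simp: \<phi>_hom)
    then show "\<phi> q \<in> ideal_gen {L F2 j, L F3 k}" by (auto simp: ideal_gen_pair)
  qed
  obtain q' where q': "q - \<phi> q = L F1 (Suc n) * q'"
    using \<phi>(1) by (metis retraction_def dvd_def)
  have h: "h - row_prod (L F1) n * \<phi> q = row_prod (L F1) (Suc n) * q'"
    using q' by (simp add: q row_prod_Suc mult.assoc flip: right_diff_distrib)
  \<comment> \<open>The easy inclusion keeps the difference inside the ideal, as the induction
    hypothesis demands.\<close>
  have "row_prod (L F1) n * \<phi> q \<in> lines_ideal" using rem gen_forms_subset by blast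
  then have "h - row_prod (L F1) n * \<phi> q \<in> lines_ideal"
    using Suc.prems(3) unfolding Int_iff mem_I3 by (blast intro: ideal_gen_diff)
  moreover have "row_prod (L F1) (Suc n) dvd h - row_prod (L F1) n * \<phi> q"
    unfolding h by (rule dvd_triv_left)
  moreover have "m = d F1 - Suc n" using Suc.hyps(2) by simp
  ultimately have "h - row_prod (L F1) n * \<phi> q \<in> ideal_gen gen_forms"
    using Suc.hyps(1) n by blast
  from ideal_gen_add[OF this rem] show ?case by simp
qed

lemma lines_ideal_eq: "lines_ideal = ideal_gen gen_forms"
  using gen_forms_subset lines_ideal_subset[of 0] by auto

end

end

section \<open>Minimal exponents\<close>

text \<open>Descent on the coordinate sum, which drops on passing to a strictly smaller
  triple.\<close>

lemma minimal_elems_below: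
  assumes "t \<in> T" obtains s where "s \<in> minimal_elems T" "le3 s t"
proof -
  have "\<exists>s\<in>minimal_elems T. le3 s t"
    using assms
  proof (induction "fst t + fst (snd t) + snd (snd t)" arbitrary: t rule: less_induct)
    case less
    show ?case
    proof (cases "t \<in> minimal_elems T")
      case False
      then obtain e where e: "e \<in> T" "e \<noteq> t" "le3 e t"
        using less.prems by (auto simp: minimal_elems_def)
      then have "fst e + fst (snd e) + snd (snd e) < fst t + fst (snd t) + snd (snd t)"
        by (cases e; cases t) (auto simp: le3_def)
      then show ?thesis using less.hyps e le3_trans by blast
    qed (use le3_refl in blast)
  qed
  then show ?thesis using that by blast
qed

lemma minimal_elems_subset: "minimal_elems T \<subseteq> T"
  by (auto simp: minimal_elems_def)

lemma minimal_elems_antichain: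
  "t \<in> minimal_elems T \<Longrightarrow> t' \<in> minimal_elems T \<Longrightarrow> le3 t t' \<Longrightarrow> t = t'"
  unfolding minimal_elems_def by blast

text \<open>A minimal element of \<open>T\<close> must equal the element of \<open>D\<close> below
  it, and anything in \<open>T\<close> below a minimal element of \<open>D\<close> is squeezed
  between that element and another one of \<open>D\<close>.\<close>

lemma minimal_elems_cong:
  assumes "D \<subseteq> T" "\<And>t. t \<in> T \<Longrightarrow> \<exists>e\<in>D. le3 e t"
  shows "minimal_elems D = minimal_elems T"
proof (intro equalityI subsetI)
  fix t assume t: "t \<in> minimal_elems D"
  then have tD: "t \<in> D" using minimal_elems_subset by blast
  have "e = t" if "e \<in> T" "le3 e t" for e
  proof -
    obtain e' where "e' \<in> D" "le3 e' e" using assms(2)[OF \<open>e \<in> T\<close>] by blast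
    then have "e' = t"
      using t le3_trans[OF \<open>le3 e' e\<close> \<open>le3 e t\<close>] unfolding minimal_elems_def by blast
    then show ?thesis using le3_antisym \<open>le3 e t\<close> \<open>le3 e' e\<close> by blast
  qed
  then show "t \<in> minimal_elems T" using tD assms(1) by (auto simp: minimal_elems_def)
next
  fix t assume t: "t \<in> minimal_elems T"
  then obtain e where "e \<in> D" "le3 e t" using assms(2) minimal_elems_subset by blast
  moreover from this have "e = t" using t assms(1) unfolding minimal_elems_def by blast
  ultimately show "t \<in> minimal_elems D" using t assms(1) unfolding minimal_elems_def by blast
qed

text \<open>Each condition on \<open>(a, b, c)\<close> involves two coordinates only. Maxima of
  triples admissible for the single diagrams are therefore admissible for all three, and every
  admissible triple lies above such a maximum.\<close>

lemma minimal_elems_D_set: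
  assumes "down_closed U3" "down_closed U2" "down_closed U1"
  shows "minimal_elems (D_set (minimal_elems (gen_exponents p q r U3 {} {}))
             (minimal_elems (gen_exponents p q r {} U2 {})) (minimal_elems (gen_exponents p q r {} {} U1)))
         = minimal_elems (gen_exponents p q r U3 U2 U1)"
    (is "minimal_elems (D_set (minimal_elems ?T3) (minimal_elems ?T2) (minimal_elems ?T1)) = minimal_elems ?T")
proof (rule minimal_elems_cong)
  \<comment> \<open>Outside a downward closed set, increasing the coordinates never leads back into
    it.\<close>
  have up: "(Suc a', Suc b') \<notin> U" if "down_closed U" "(Suc a, Suc b) \<notin> U" "a \<le> a'" "b \<le> b'"
    for a b a' b' and U :: "(nat \<times> nat) set"
    using that down_closedD[OF that(1), of "Suc a'" "Suc b'" "Suc a" "Suc b"] by auto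
  show "D_set (minimal_elems ?T3) (minimal_elems ?T2) (minimal_elems ?T1) \<subseteq> ?T"
  proof
    fix t assume "t \<in> D_set (minimal_elems ?T3) (minimal_elems ?T2) (minimal_elems ?T1)"
    then obtain a3 b3 a2 c2 b1 c1 where t: "t = (max a3 a2, max b3 b1, max c1 c2)"
      and "(a3, b3, 0) \<in> ?T3" "(a2, 0, c2) \<in> ?T2" "(0, b1, c1) \<in> ?T1"
      unfolding D_set_def minimal_elems_def by blast
    then show "t \<in> ?T"
      using up[OF assms(1), of a3 b3 "max a3 a2" "max b3 b1"]
        up[OF assms(2), of a2 c2 "max a3 a2" "max c1 c2"]
        up[OF assms(3), of b1 c1 "max b3 b1" "max c1 c2"]
      by (simp add: gen_exponents_def)
  qed
next
  fix t assume "t \<in> ?T"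
  obtain a b c where abc: "t = (a, b, c)" by (cases t)
  \<comment> \<open>With the other two diagrams empty the missing coordinate may be set to 0;
    minimal triples below then have a 0 there too, as \<open>D_set\<close> requires.\<close>
  have "(a, b, 0) \<in> ?T3" "(a, 0, c) \<in> ?T2" "(0, b, c) \<in> ?T1"
    using \<open>t \<in> ?T\<close> by (auto simp: abc gen_exponents_def)
  then obtain s3 s2 s1 where s: "s3 \<in> minimal_elems ?T3" "le3 s3 (a, b, 0)"
    "s2 \<in> minimal_elems ?T2" "le3 s2 (a, 0, c)" "s1 \<in> minimal_elems ?T1" "le3 s1 (0, b, c)"
    using minimal_elems_below by metis
  obtain a3 b3 where 3: "s3 = (a3, b3, 0)" "a3 \<le> a" "b3 \<le> b"
    using s(2) by (cases s3) (auto simp: le3_def)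
  obtain a2 c2 where 2: "s2 = (a2, 0, c2)" "a2 \<le> a" "c2 \<le> c"
    using s(4) by (cases s2) (auto simp: le3_def)
  obtain b1 c1 where 1: "s1 = (0, b1, c1)" "b1 \<le> b" "c1 \<le> c"
    using s(6) by (cases s1) (auto simp: le3_def)
  have "(max a3 a2, max b3 b1, max c1 c2) \<in> D_set (minimal_elems ?T3) (minimal_elems ?T2) (minimal_elems ?T1)"
    using s(1,3,5) unfolding 1 2 3 D_set_def by blast
  moreover have "le3 (max a3 a2, max b3 b1, max c1 c2) t"
    using 1 2 3 by (simp add: abc le3_def)
  ultimately show "\<exists>e\<in>D_set (minimal_elems ?T3) (minimal_elems ?T2) (minimal_elems ?T1). le3 e t"
    by blast
qed

section \<open>Tridegrees of the products and minimal generation\<close>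

lemma linear_form_homogeneous:
  assumes "linear_form f A"
  shows "homogeneous A (case f of F1 \<Rightarrow> (1, 0, 0) | F2 \<Rightarrow> (0, 1, 0) | F3 \<Rightarrow> (0, 0, 1))"
proof -
  obtain \<alpha> \<beta> where "A = pconst \<alpha> * pvar (Var f False) + pconst \<beta> * pvar (Var f True)"
    using assms unfolding linear_form_def by blast
  then have A: "A = Poly_Mapping.single (Poly_Mapping.single (Var f False) 1) \<alpha>
      + Poly_Mapping.single (Poly_Mapping.single (Var f True) 1) \<beta>"
    by (simp add: pconst_def pvar_def mult_single)
  have "m = Poly_Mapping.single (Var f False) 1 \<or> m = Poly_Mapping.single (Var f True) 1"
    if "m \<in> Poly_Mapping.keys A" for m
    using that keys_add[of "Poly_Mapping.single (Poly_Mapping.single (Var f False) 1) \<alpha>"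
        "Poly_Mapping.single (Poly_Mapping.single (Var f True) 1) \<beta>"]
    unfolding A by (auto split: if_splits simp del: One_nat_def)
  then show ?thesis
    unfolding homogeneous_def by (cases f) (force simp: tdeg_def lookup_single when_def)+
qed

lemma row_prod_homogeneous:
  assumes "\<And>i. 1 \<le> i \<Longrightarrow> i \<le> n \<Longrightarrow> homogeneous (A i) (x, y, z)"
  shows "homogeneous (row_prod A n) (n * x, n * y, n * z)"
  using assms
proof (induction n)
  case 0
  show ?case by (simp add: homogeneous_def tdeg_def)
next
  case (Suc n)
  have "homogeneous (row_prod A n * A (Suc n)) ((n * x, n * y, n * z) + (x, y, z))"
    by (intro homogeneous_mult Suc.IH Suc.prems) auto
  then show ?case by (simp add: row_prod_Suc add.commute)
qed

lemma staircase_form_dvd_mono: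
  assumes "le3 s t" shows "staircase_form A B C s dvd staircase_form A B C t"
  using assms by (cases s; cases t) (auto simp: staircase_form_def le3_def intro!: mult_dvd_mono row_prod_dvd_mono)

context independent_forms begin

lemma staircase_form_homogeneous:
  assumes "a \<le> d F1" "b \<le> d F2" "c \<le> d F3"
  shows "homogeneous (staircase_form (L F1) (L F2) (L F3) (a, b, c)) (a, b, c)"
proof -
  have "homogeneous (row_prod (L F1) a) (a * 1, a * 0, a * 0)"
    using linear_form_homogeneous[OF linear[of _ F1]] assms(1) by (intro row_prod_homogeneous) auto
  moreover have "homogeneous (row_prod (L F2) b) (b * 0, b * 1, b * 0)"
    using linear_form_homogeneous[OF linear[of _ F2]] assms(2) by (intro row_prod_homogeneous) auto
  moreover have "homogeneous (row_prod (L F3) c) (c * 0, c * 0, c * 1)"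
    using linear_form_homogeneous[OF linear[of _ F3]] assms(3) by (intro row_prod_homogeneous) auto
  ultimately have "homogeneous (row_prod (L F1) a * row_prod (L F2) b * row_prod (L F3) c)
      ((a * 1, a * 0, a * 0) + (b * 0, b * 1, b * 0) + (c * 0, c * 0, c * 1))"
    by (intro homogeneous_mult)
  then show ?thesis by (simp add: staircase_form_def)
qed

lemma row_prod_neq_0: "n \<le> d f \<Longrightarrow> row_prod (L f) n \<noteq> 0"
  using form_neq_0 by (simp add: row_prod_def)

context
  fixes U3 U2 U1 :: "(nat \<times> nat) set"
  assumes U3: "down_closed U3" "U3 \<subseteq> {1..d F1} \<times> {1..d F2}"
    and U2: "down_closed U2" "U2 \<subseteq> {1..d F1} \<times> {1..d F3}"
    and U1: "down_closed U1" "U1 \<subseteq> {1..d F2} \<times> {1..d F3}"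
begin

abbreviation "exponents \<equiv> gen_exponents (d F1) (d F2) (d F3) U3 U2 U1"

text \<open>A product with larger exponents is a multiple of one with smaller exponents, so the
  minimal exponents suffice.\<close>

lemma lines_ideal_eq_minimal:
  "I3 (L F1) (L F2) U3 \<inter> I3 (L F1) (L F3) U2 \<inter> I3 (L F2) (L F3) U1
     = ideal_gen (staircase_form (L F1) (L F2) (L F3) ` minimal_elems exponents)"
  unfolding lines_ideal_eq[OF U3 U2 U1]
proof
  show "ideal_gen (staircase_form (L F1) (L F2) (L F3) ` exponents)
      \<subseteq> ideal_gen (staircase_form (L F1) (L F2) (L F3) ` minimal_elems exponents)"
  proof (rule ideal_gen_subsetI)
    fix g assume "g \<in> staircase_form (L F1) (L F2) (L F3) ` exponents"
    then obtain t where t: "t \<in> exponents" "g = staircase_form (L F1) (L F2) (L F3) t" by blast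
    obtain s where "s \<in> minimal_elems exponents" "le3 s t" using minimal_elems_below[OF t(1)] .
    then show "g \<in> ideal_gen (staircase_form (L F1) (L F2) (L F3) ` minimal_elems exponents)"
      unfolding t(2) by (intro ideal_gen_dvd[OF ideal_gen_base staircase_form_dvd_mono]) auto
  qed
qed (intro ideal_gen_mono image_mono minimal_elems_subset)

lemma minimal_exponent_form:
  assumes "t \<in> minimal_elems exponents"
  shows "homogeneous (staircase_form (L F1) (L F2) (L F3) t) t"
    and "staircase_form (L F1) (L F2) (L F3) t \<noteq> 0"
proof -
  obtain a b c where t: "t = (a, b, c)" "a \<le> d F1" "b \<le> d F2" "c \<le> d F3"
    using subsetD[OF minimal_elems_subset assms] by (auto simp: gen_exponents_def)
  show "homogeneous (staircase_form (L F1) (L F2) (L F3) t) t"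
    unfolding t(1) by (rule staircase_form_homogeneous[OF t(2-4)])
  show "staircase_form (L F1) (L F2) (L F3) t \<noteq> 0"
    using t(2-4) row_prod_neq_0 by (simp add: t(1) staircase_form_def)
qed

lemma lines_ideal_min_gens:
  "min_gens (I3 (L F1) (L F2) U3 \<inter> I3 (L F1) (L F3) U2 \<inter> I3 (L F2) (L F3) U1)
     (staircase_form (L F1) (L F2) (L F3) ` minimal_elems exponents)"
  unfolding lines_ideal_eq_minimal
  by (rule antichain_min_gens) (use minimal_exponent_form minimal_elems_antichain in blast)+

lemma lines_ideal_gen_degrees:
  "gen_degrees (I3 (L F1) (L F2) U3 \<inter> I3 (L F1) (L F3) U2 \<inter> I3 (L F2) (L F3) U1)
     = minimal_elems exponents"
  unfolding lines_ideal_eq_minimal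
  by (rule antichain_gen_degrees) (use minimal_exponent_form minimal_elems_antichain in blast)+

end

end

theorem theorem4p3:
  fixes A B C :: "nat \<Rightarrow> 'k::{alg_closed_field, field_char_0} mpoly"
    and d1 d2 d3 :: nat
    and U3 U2 U1 :: "(nat \<times> nat) set"
  assumes linA: "\<forall>i\<in>{1..d1}. linear_form F1 (A i)"
      and linB: "\<forall>j\<in>{1..d2}. linear_form F2 (B j)"
      and linC: "\<forall>k\<in>{1..d3}. linear_form F3 (C k)"
      and distA: "\<forall>i\<in>{1..d1}. \<forall>i'\<in>{1..d1}. \<forall>c. i \<noteq> i' \<longrightarrow> A i \<noteq> pconst c * A i'"
      and distB: "\<forall>j\<in>{1..d2}. \<forall>j'\<in>{1..d2}. \<forall>c. j \<noteq> j' \<longrightarrow> B j \<noteq> pconst c * B j'"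
      and distC: "\<forall>k\<in>{1..d3}. \<forall>k'\<in>{1..d3}. \<forall>c. k \<noteq> k' \<longrightarrow> C k \<noteq> pconst c * C k'"
      and U3sub: "U3 \<subseteq> {1..d1} \<times> {1..d2}"
      and U2sub: "U2 \<subseteq> {1..d1} \<times> {1..d3}"
      and U1sub: "U1 \<subseteq> {1..d2} \<times> {1..d3}"
      and usedA: "\<forall>i\<in>{1..d1}. (\<exists>j. (i, j) \<in> U3) \<or> (\<exists>k. (i, k) \<in> U2)"
      and usedB: "\<forall>j\<in>{1..d2}. (\<exists>i. (i, j) \<in> U3) \<or> (\<exists>k. (j, k) \<in> U1)"
      and usedC: "\<forall>k\<in>{1..d3}. (\<exists>i. (i, k) \<in> U2) \<or> (\<exists>j. (j, k) \<in> U1)"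
      and ferrers: "down_closed U3" "down_closed U2" "down_closed U1"
  shows "min_gens (I3 A B U3 \<inter> I3 A C U2 \<inter> I3 B C U1)
           {(\<Prod>i\<in>{1..a}. A i) * (\<Prod>j\<in>{1..b}. B j) * (\<Prod>k\<in>{1..c}. C k) | a b c.
              (a, b, c) \<in> minimal_elems
                 (D_set (gen_degrees (I3 A B U3)) (gen_degrees (I3 A C U2)) (gen_degrees (I3 B C U1)))}"
proof -
  \<comment> \<open>The three families are packed into one indexed by the factor, to match the
    locale.\<close>
  define L where "L f = (case f of F1 \<Rightarrow> A | F2 \<Rightarrow> B | F3 \<Rightarrow> C)" for f
  define d where "d f = (case f of F1 \<Rightarrow> d1 | F2 \<Rightarrow> d2 | F3 \<Rightarrow> d3)" for f
  have L [simp]: "L F1 = A" "L F2 = B" "L F3 = C" and d [simp]: "d F1 = d1" "d F2 = d2" "d F3 = d3"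
    by (simp_all add: L_def d_def)
  interpret independent_forms L d
  proof
    show "linear_form f (L f i)" if "1 \<le> i" "i \<le> d f" for f i
      using that linA linB linC by (cases f) auto
    show "L f i \<noteq> pconst c * L f j" if "1 \<le> i" "i \<le> d f" "1 \<le> j" "j \<le> d f" "i \<noteq> j" for f i j c
      using that distA distB distC by (cases f) auto
  qed
  \<comment> \<open>An empty diagram imposes no condition and its ideal is the whole ring, so the
    results for three diagrams specialise to each single one.\<close>
  have empty: "down_closed {}" "{} \<subseteq> S" "I3 X Y {} = UNIV"
    for S :: "(nat \<times> nat) set" and X Y :: "nat \<Rightarrow> 'k mpoly"
    by (simp_all add: down_closed_def I3_def)
  note sub = U3sub[folded d] U2sub[folded d] U1sub[folded d]
  have "gen_degrees (I3 A B U3) = minimal_elems (gen_exponents d1 d2 d3 U3 {} {})"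
    using lines_ideal_gen_degrees[OF ferrers(1) sub(1) empty(1,2) empty(1,2)] by (simp add: empty(3))
  moreover have "gen_degrees (I3 A C U2) = minimal_elems (gen_exponents d1 d2 d3 {} U2 {})"
    using lines_ideal_gen_degrees[OF empty(1,2) ferrers(2) sub(2) empty(1,2)] by (simp add: empty(3))
  moreover have "gen_degrees (I3 B C U1) = minimal_elems (gen_exponents d1 d2 d3 {} {} U1)"
    using lines_ideal_gen_degrees[OF empty(1,2) empty(1,2) ferrers(3) sub(3)] by (simp add: empty(3))
  ultimately have "minimal_elems (D_set (gen_degrees (I3 A B U3)) (gen_degrees (I3 A C U2)) (gen_degrees (I3 B C U1)))
      = minimal_elems (gen_exponents d1 d2 d3 U3 U2 U1)"
    using minimal_elems_D_set[OF ferrers] by simp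
  moreover have "min_gens (I3 A B U3 \<inter> I3 A C U2 \<inter> I3 B C U1)
      (staircase_form A B C ` minimal_elems (gen_exponents d1 d2 d3 U3 U2 U1))"
    using lines_ideal_min_gens[OF ferrers(1) sub(1) ferrers(2) sub(2) ferrers(3) sub(3)] by simp
  moreover have "staircase_form A B C ` S
      = {(\<Prod>i\<in>{1..a}. A i) * (\<Prod>j\<in>{1..b}. B j) * (\<Prod>k\<in>{1..c}. C k) | a b c. (a, b, c) \<in> S}" for S
    by (force simp: staircase_form_def row_prod_def)
  ultimately show ?thesis by simp
qed

end
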